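(* Let $N\ge2$, $R>0$, let $g:[0,R]\to(0,\infty)$ be smooth, and let $A,B,p,q$ be positive constants with $A\ne B$, all independent of $\epsilon$. For $\epsilon>0$ let $U_\epsilon$ be the unique solution of problem (N* ) described in the context, and let $\rho_\epsilon$ be as in the context. If $0<A<B$ (resp. $0<B<A$), then $U_\epsilon$ is monotonically decreasing (resp. increasing) on $[0,R]$. Moreover: (I) For every $\kappa\in(0,1)$ independent of $\epsilon$ there are positive constants $C_\kappa,M_\kappa$ independent of $\epsilon$ such that for all sufficiently small $\epsilon>0$, $$\max_{r\in[0,R-\epsilon^\kappa]}|U_\epsilon(r)|\le C_\kappa\epsilon^\kappa\log\frac1\epsilon\quad\text{and}\quad\max_{r\in[0,R-\epsilon^\kappa]}r^{N-1}|U_\epsilon'(r)|\le e^{-M_\kappa/\epsilon^{1-\kappa}}.$$ (II) Let $\beta>1$ and $\gamma_\beta\in(0,\infty)$ be independent of $\epsilon$ and let $r_{\epsilon,\beta}\in(0,R)$ satisfy $\lim_{\epsilon\downarrow0}\frac{R-r_{\epsilon,\beta}}{\epsilon^\beta}=\gamma_\beta$. Define $\chi_1(\beta)=1,\chi_2(\beta)=0$ for $\beta\in(1,2)$; $\chi_1(\beta)=\chi_2(\beta)=1$ for $\beta=2$; $\chi_1(\beta)=0,\chi_2(\beta)=1$ for $\beta>2$. Then as $\epsilon\downarrow0$, $$U_\epsilon(r_{\epsilon,\beta})=-\frac2q\min\{1,\beta-1\}\log\frac1\epsilon+\frac2q\log\Big[\sqrt{\frac{A}{2qg(R)}}\Big(\gamma_\beta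 q\chi_1(\beta)+\frac{2Ng(R)}{R(B-A)}\chi_2(\beta)\Big)\Big]+o_\epsilon(1)\quad\text{if }0<A<B,$$ $$U_\epsilon(r_{\epsilon,\beta})=\frac2p\min\{1,\beta-1\}\log\frac1\epsilon-\frac2p\log\Big[\sqrt{\frac{B}{2pg(R)}}\Big(\gamma_\beta p\chi_1(\beta)+\frac{2Ng(R)}{R(A-B)}\chi_2(\beta)\Big)\Big]+o_\epsilon(1)\quad\text{if }0<B<A.$$ Furthermore, if $0<A<B$, then as $\epsilon\downarrow0$: (a) if $1<\beta<2$: $U_\epsilon'(r_{\epsilon,\beta})=-\frac{2}{\gamma_\beta q}\epsilon^{-\beta}(1+o_\epsilon(1))$ and $\rho_\epsilon(r_{\epsilon,\beta})=\frac{2g(R)}{\gamma_\beta^2q}\epsilon^{-2(\beta-1)}(1+o_\epsilon(1))$; (b) if $\beta=2$: $U_\epsilon'(r_{\epsilon,\beta})=-\frac{2}{\gamma_\beta q+\frac{2Ng(R)}{R(B-A)}}\epsilon^{-2}(1+o_\epsilon(1))$ and $\rho_\epsilon(r_{\epsilon,\beta})=\frac{2qg(R)}{(\gamma_\beta q+\frac{2Ng(R)}{R(B-A)})^2}\epsilon^{-2}(1+o_\epsilon(1))$; (c) if $\beta>2$: $U_\epsilon'(r_{\epsilon,\beta})=-\frac{R(B-A)}{Ng(R)}\epsilon^{-2}(1+o_\epsilon(1))$ and $\rho_\epsilon(r_{\epsilon,\beta})=\frac{qR^2(B-A)^2}{2N^2g(R)}\epsilon^{-2}(1+o_\epsilon(1))$;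 in this case $U_\epsilon(r_{\epsilon,\beta})$ and $U_\epsilon(R)$ have the same first two terms in their asymptotic expansions, and $U_\epsilon'(r_{\epsilon,\beta})$ and $U_\epsilon'(R)$ have the same leading order term.
   Context: Problem (N* ): for $\epsilon>0$, find $U_\epsilon\in C^1([0,R])\cap C^\infty((0,R))$ such that for $r\in(0,R)$ $$\epsilon^2 g(r)\Big[U_\epsilon''(r)+\Big(\frac{N-1}{r}+\frac{g'(r)}{g(r)}\Big)U_\epsilon'(r)\Big]=\frac{R^N}{N}\Big(\frac{Ae^{pU_\epsilon(r)}}{\int_0^R s^{N-1}e^{pU_\epsilon(s)}ds}-\frac{Be^{-qU_\epsilon(r)}}{\int_0^R s^{N-1}e^{-qU_\epsilon(s)}ds}\Big),$$ together with $\int_0^R s^{N-1}U_\epsilon(s)\,ds=0$, $U_\epsilon'(0)=0$ and $U_\epsilon'(R)=\frac{R(A-B)}{\epsilon^2Ng(R)}$; it has a unique solution. The net charge density is $\rho_\epsilon(r)=-\frac{R^N}{N}\big(\frac{Ae^{pU_\epsilon(r)}}{\int_0^Rs^{N-1}e^{pU_\epsilon(s)}ds}-\frac{Be^{-qU_\epsilon(r)}}{\int_0^Rs^{N-1}e^{-qU_\epsilon(s)}ds}\big)$. Notation: $o_\epsilon(1)$ denotes a quantity tending to $0$ as $\epsilon\downarrow0$. *)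

theory Defs
  imports "HOL-Analysis.Analysis"
begin

definition smooth_on :: "real set \<Rightarrow> (real \<Rightarrow> real) \<Rightarrow> bool" where
  "smooth_on S f \<longleftrightarrow> (\<exists>D::nat \<Rightarrow> real \<Rightarrow> real. (\<forall>x\<in>S. D 0 x = f x) \<and>
     (\<forall>k. \<forall>x\<in>S. (D k has_real_derivative D (Suc k) x) (at x within S)))"

definition nstar_rhs :: "nat \<Rightarrow> real \<Rightarrow> real \<Rightarrow> real \<Rightarrow> real \<Rightarrow> real \<Rightarrow> (real \<Rightarrow> real) \<Rightarrow> real \<Rightarrow> real" where
  "nstar_rhs N R A B p q U r =
     (R ^ N / real N) *
       (A * exp (p * U r) / integral {0..R} (\<lambda>s. s ^ (N - 1) * exp (p * U s))
        - B * exp (- q * U r) / integral {0..R} (\<lambda>s. s ^ (N - 1) * exp (- q * U s)))"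

definition rho :: "nat \<Rightarrow> real \<Rightarrow> real \<Rightarrow> real \<Rightarrow> real \<Rightarrow> real \<Rightarrow> (real \<Rightarrow> real) \<Rightarrow> real \<Rightarrow> real" where
  "rho N R A B p q U r = - nstar_rhs N R A B p q U r"

definition solves_Nstar ::
  "nat \<Rightarrow> real \<Rightarrow> (real \<Rightarrow> real) \<Rightarrow> real \<Rightarrow> real \<Rightarrow> real \<Rightarrow> real \<Rightarrow> real
    \<Rightarrow> (real \<Rightarrow> real) \<Rightarrow> (real \<Rightarrow> real) \<Rightarrow> bool" where
  "solves_Nstar N R g A B p q eps U U' \<longleftrightarrow>
     (\<forall>r\<in>{0..R}. (U has_real_derivative U' r) (at r within {0..R})) \<and>
     continuous_on {0..R} U' \<and>
     smooth_on {0<..<R} U \<and>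
     (\<forall>r\<in>{0<..<R}. eps\<^sup>2 * g r * (deriv U' r + ((real N - 1) / r + deriv g r / g r) * U' r)
                      = nstar_rhs N R A B p q U r) \<and>
     integral {0..R} (\<lambda>s. s ^ (N - 1) * U s) = 0 \<and>
     U' 0 = 0 \<and>
     U' R = R * (A - B) / (eps\<^sup>2 * real N * g R)"

definition chi1 :: "real \<Rightarrow> real" where
  "chi1 \<beta> = (if \<beta> \<le> 2 then 1 else 0)"

definition chi2 :: "real \<Rightarrow> real" where
  "chi2 \<beta> = (if \<beta> \<ge> 2 then 1 else 0)"

end

theory Submission
  imports Defs "HOL-Real_Asymp.Real_Asymp"
begin

text \<open>
  Replacing \<open>U\<close> by \<open>-U\<close> and exchanging \<open>(A, p)\<close> with \<open>(B, q)\<close>, assume \<open>A < B\<close>. Write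
  \<open>E = b exp (-q U)\<close> and \<open>P = a exp (p U)\<close> with the nonlocal coefficients \<open>a\<close>, \<open>b\<close>, so that \<open>\<rho> = E - P\<close>
  and \<open>W = -r^(N-1) g U'\<close> satisfies \<open>\<epsilon>\<^sup>2 W' = r^(N-1) \<rho>\<close>. Then \<open>W\<close> and \<open>\<rho>\<close> are nonnegative, and \<open>a\<close>, \<open>b\<close>
  stay between positive constants. Comparing \<open>\<rho>\<^sup>2\<close> with \<open>\<epsilon>\<^sup>2 W\<^sup>2\<close> gives exponential decay of \<open>W\<close> away from
  \<open>r = R\<close>; with the mean-zero condition this controls \<open>U\<close> in the bulk and forces \<open>a, b \<rightarrow> A\<close>.
  Near \<open>r = R\<close> the first integral \<open>\<epsilon>\<^sup>2 (W\<^sup>2)'/2 = r^(2N-2) g (E/q + P/p)'\<close> yields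
  \<open>-\<epsilon> U' / sqrt E \<rightarrow> sqrt (2 / (q g R))\<close>. Since \<open>(1 / sqrt E)' = (q/2) U' / sqrt E\<close>, the function
  \<open>1 / sqrt E\<close> is asymptotically affine in \<open>R - r\<close> with slope of order \<open>1/\<epsilon>\<close>, and its value at \<open>R\<close> is fixed by
  the boundary condition. This determines \<open>U\<close>, \<open>U'\<close> and \<open>\<rho>\<close> in the boundary layer.
\<close>

section \<open>Limits, regularity of solutions and the reflection symmetry\<close>

lemma tendsto_eq_eventually:
  "(f \<longlongrightarrow> a) F \<Longrightarrow> a = b \<Longrightarrow> eventually (\<lambda>x. f x = h x) F \<Longrightarrow> (h \<longlongrightarrow> b) F"
  using Lim_transform_eventually by blast

lemma smooth_on_continuous_on: "smooth_on S f \<Longrightarrow> continuous_on S f"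
proof -
  assume "smooth_on S f"
  then obtain D where D: "\<forall>x\<in>S. D 0 x = f x"
    "\<forall>k. \<forall>x\<in>S. (D k has_real_derivative D (Suc k) x) (at x within S)"
    unfolding smooth_on_def by blast
  have "continuous_on S (D 0)"
    using D(2) by (meson DERIV_continuous_on)
  then show ?thesis
    using D(1) by (metis (no_types, lifting) continuous_on_cong)
qed

lemma smooth_on_minus: "smooth_on S f \<Longrightarrow> smooth_on S (\<lambda>x. - f x)"
proof -
  assume "smooth_on S f"
  then obtain D where D: "\<forall>x\<in>S. D 0 x = f x"
    "\<forall>k. \<forall>x\<in>S. (D k has_real_derivative D (Suc k) x) (at x within S)"
    unfolding smooth_on_def by blast
  then show ?thesis
    unfolding smooth_on_def
    by (intro exI[of _ "\<lambda>k x. - D k x"]) (auto intro!: DERIV_minus)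
qed

text \<open>\<open>U'\<close> is only assumed continuous, and \<open>deriv U'\<close> in the
  equation is informative only where \<open>U'\<close> is differentiable. The smoothness witness
  supplies this: \<open>D 1\<close> agrees with \<open>U'\<close> on the open interval by uniqueness
  of derivatives, so \<open>D 2\<close> is a derivative of \<open>U'\<close>.\<close>

lemma solves_Nstar_deriv:
  assumes sol: "solves_Nstar N R g A B p q eps U U'" and r: "0 < r" "r < R"
  shows "(U' has_real_derivative deriv U' r) (at r)"
proof -
  from sol obtain D where D: "\<forall>x\<in>{0<..<R}. D 0 x = U x"
    "\<forall>k. \<forall>x\<in>{0<..<R}. (D k has_real_derivative D (Suc k) x) (at x within {0<..<R})"
    unfolding smooth_on_def solves_Nstar_def by blast
  have D': "(D k has_real_derivative D (Suc k) x) (at x)" if "x \<in> {0<..<R}" for k x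
    using D(2) that by (metis at_within_open open_greaterThanLessThan)
  have 1: "D 1 x = U' x" if x: "x \<in> {0<..<R}" for x
  proof -
    have "(U has_real_derivative D 1 x) (at x)"
      using D'[OF x, of 0] unfolding One_nat_def
      by (rule has_field_derivative_transform_within_open[of _ _ _ "{0<..<R}"]) (use x D(1) in auto)
    moreover have "(U has_real_derivative U' x) (at x within {0..R})"
      using sol x unfolding solves_Nstar_def by auto
    then have "(U has_real_derivative U' x) (at x)"
      using x by (simp add: at_within_Icc_at)
    ultimately show ?thesis
      using DERIV_unique by blast
  qed
  have "(U' has_real_derivative D 2 r) (at r)"
  proof (rule has_field_derivative_transform_within_open[of "D 1" _ _ "{0<..<R}"])
    show "(D 1 has_real_derivative D 2 r) (at r)"
      using D'[of r 1] r by (simp add: numeral_2_eq_2)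
  qed (use r 1 in auto)
  then show ?thesis
    using DERIV_imp_deriv by fastforce
qed

text \<open>Negating \<open>U\<close> and exchanging (\<open>A\<close>, \<open>p\<close>) with
  (\<open>B\<close>, \<open>q\<close>) swaps the two exponential terms, so both sides of the
  equation and the boundary datum change sign. This carries results for \<open>A < B\<close> over to
  \<open>B < A\<close>.\<close>

lemma solves_Nstar_minus:
  assumes sol: "solves_Nstar N R g A B p q eps U U'"
  shows "solves_Nstar N R g B A q p eps (\<lambda>r. - U r) (\<lambda>r. - U' r)"
proof -
  have rhs: "nstar_rhs N R B A q p (\<lambda>r. - U r) r = - nstar_rhs N R A B p q U r" for r
    unfolding nstar_rhs_def by (simp add: right_diff_distrib)
  have d: "deriv (\<lambda>r. - U' r) r = - deriv U' r" if "r \<in> {0<..<R}" for r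
    using solves_Nstar_deriv[OF sol, of r] that by (auto intro!: DERIV_imp_deriv DERIV_minus)
  have ode: "eps\<^sup>2 * g r * (deriv (\<lambda>r. - U' r) r + ((real N - 1) / r + deriv g r / g r) * - U' r)
      = nstar_rhs N R B A q p (\<lambda>r. - U r) r" if "r \<in> {0<..<R}" for r
  proof -
    have "deriv (\<lambda>r. - U' r) r + ((real N - 1) / r + deriv g r / g r) * - U' r
        = - (deriv U' r + ((real N - 1) / r + deriv g r / g r) * U' r)"
      unfolding d[OF that] by simp
    then have "eps\<^sup>2 * g r * (deriv (\<lambda>r. - U' r) r + ((real N - 1) / r + deriv g r / g r) * - U' r)
        = - (eps\<^sup>2 * g r * (deriv U' r + ((real N - 1) / r + deriv g r / g r) * U' r))"
      by (metis mult_minus_right)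
    then show ?thesis
      using sol that unfolding rhs solves_Nstar_def by metis
  qed
  have "- (R * (A - B) / (eps\<^sup>2 * real N * g R)) = R * (B - A) / (eps\<^sup>2 * real N * g R)"
    by (metis minus_diff_eq minus_divide_left mult_minus_right)
  with sol ode show ?thesis
    unfolding solves_Nstar_def
    by (simp add: DERIV_minus smooth_on_minus continuous_on_minus)
qed

section \<open>A priori estimates\<close>

text \<open>No \<open>\<epsilon>\<close> among the parameters: the constants defined here are therefore uniform in \<open>\<epsilon>\<close>.\<close>

locale nstar_data =
  fixes N :: nat and R A B p q gl gu :: real and g :: "real \<Rightarrow> real"
  assumes N: "N \<ge> 2" and R: "R > 0" and gsmooth: "smooth_on {0..R} g"
    and gl: "gl > 0" and glu: "\<And>r. r \<in> {0..R} \<Longrightarrow> gl \<le> g r \<and> g r \<le> gu"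
    and A: "A > 0" and p: "p > 0" and q: "q > 0" and AB: "A < B"
begin

definition coefA :: "(real \<Rightarrow> real) \<Rightarrow> real" where
  "coefA V = R ^ N / real N * A / integral {0..R} (\<lambda>s. s ^ (N - 1) * exp (p * V s))"

definition coefB :: "(real \<Rightarrow> real) \<Rightarrow> real" where
  "coefB V = R ^ N / real N * B / integral {0..R} (\<lambda>s. s ^ (N - 1) * exp (- q * V s))"

definition P :: "(real \<Rightarrow> real) \<Rightarrow> real \<Rightarrow> real" where
  "P V r = coefA V * exp (p * V r)"

definition E :: "(real \<Rightarrow> real) \<Rightarrow> real \<Rightarrow> real" where
  "E V r = coefB V * exp (- q * V r)"

text \<open>Potential of the first integral: along a solution its derivative is
  \<open>- U' r * net U r\<close>.\<close>

definition H :: "(real \<Rightarrow> real) \<Rightarrow> real \<Rightarrow> real" where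
  "H V r = E V r / q + P V r / p"

definition net :: "(real \<Rightarrow> real) \<Rightarrow> real \<Rightarrow> real" where
  "net V r = E V r - P V r"

text \<open>The flux whose derivative puts the equation in divergence form; the minus sign makes it
  nonnegative when \<open>A < B\<close>.\<close>

definition W :: "(real \<Rightarrow> real) \<Rightarrow> real \<Rightarrow> real" where
  "W V' r = - (r ^ (N - 1) * g r * V' r)"

text \<open>Solves \<open>A = B * exp (- q * umax)\<close>, the extreme case allowed by
  \<open>A \<le> E U 0\<close> and \<open>coefB U \<le> B\<close>.\<close>

definition umax :: real where "umax = ln (B / A) / q"
definition Pmax :: real where "Pmax = A * exp (p * umax)"
text \<open>Lower bound for \<open>q * E U r + p * P U r\<close>, the growth of the density per unit
  decrease of \<open>U\<close>. The first entry serves \<open>U r \<le> 0\<close>, where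
  \<open>E\<close> is at least \<open>A\<close>; the second serves \<open>U r > 0\<close>, where
  \<open>P\<close> is at least \<open>A * exp (- p * umax)\<close>.\<close>

definition slope :: real where "slope = min (A * q) (p * A * exp (- p * umax))"
text \<open>Normalised so that \<open>gap\<close> times the weight r^(2N-2) g(r) never exceeds
  \<open>slope\<close>.\<close>

definition gap :: real where "gap = slope / ((R ^ (N - 1))\<^sup>2 * gu)"
text \<open>The division by \<open>N\<close> comes from integrating r^(N-1); the factor R^(N-1)
  comes from bounding R^N - r^N below by a multiple of R - r.\<close>

definition rate :: real where "rate = sqrt gap * R ^ (N - 1) / real N"
text \<open>The value of \<open>eps\<^sup>2 * W U' R\<close>, which the boundary condition fixes
  independently of \<open>eps\<close>.\<close>

definition flux :: real where "flux = R ^ N * (B - A) / real N"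

lemma B: "B > 0"
  using A AB by linarith

lemma gu: "gu > 0"
  using glu[of 0] gl R by auto

lemma g_pos: "r \<in> {0..R} \<Longrightarrow> g r > 0"
  using glu[of r] gl by linarith

lemma N_facts: "R ^ (N - 1) * R = R ^ N" "N - 1 > 0" "N > 0"
  using N by (auto simp: power_eq_if)

lemma g_cont: "continuous_on {0..R} g"
  by (rule smooth_on_continuous_on[OF gsmooth])

lemma g_deriv: "0 < r \<Longrightarrow> r < R \<Longrightarrow> (g has_real_derivative deriv g r) (at r)"
proof -
  assume r: "0 < r" "r < R"
  from gsmooth obtain D where D: "\<forall>x\<in>{0..R}. D 0 x = g x"
    "\<forall>k. \<forall>x\<in>{0..R}. (D k has_real_derivative D (Suc k) x) (at x within {0..R})"
    unfolding smooth_on_def by blast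
  have "(D 0 has_real_derivative D 1 r) (at r within {0..R})"
    using D(2) r by auto
  then have "(g has_real_derivative D 1 r) (at r within {0..R})"
    by (rule has_field_derivative_transform_within[of _ _ _ _ 1]) (use r D(1) in auto)
  then have "(g has_real_derivative D 1 r) (at r)"
    using r by (simp add: at_within_Icc_at)
  then show ?thesis
    using DERIV_imp_deriv by fastforce
qed

lemma integral_weight: "((\<lambda>s. s ^ (N - 1)) has_integral R ^ N / real N) {0..R}"
proof -
  have "((\<lambda>s. s ^ (N - 1)) has_integral (R ^ N / real N - 0 ^ N / real N)) {0..R}"
  proof (rule fundamental_theorem_of_calculus)
    fix x assume "x \<in> {0..R}"
    have "((\<lambda>s. s ^ N / real N) has_real_derivative x ^ (N - 1)) (at x within {0..R})"
      using N_facts by (auto intro!: derivative_eq_intros)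
    then show "((\<lambda>s. s ^ N / real N) has_vector_derivative x ^ (N - 1)) (at x within {0..R})"
      by (simp add: has_real_derivative_iff_has_vector_derivative)
  qed (use R in auto)
  then show ?thesis
    using N_facts by (simp add: power_0_left)
qed

lemma slope_pos: "slope > 0"
  unfolding slope_def using A p q by auto

lemma gap_pos: "gap > 0"
  unfolding gap_def using slope_pos gu R by auto

lemma rate_pos: "rate > 0"
  unfolding rate_def using gap_pos R N_facts by auto

lemma flux_pos: "flux > 0"
  unfolding flux_def using R AB N_facts by auto

end

section \<open>The equation in divergence form, for one fixed solution\<close>

locale nstar_solution = nstar_data +
  fixes eps :: real and U U' :: "real \<Rightarrow> real"
  assumes eps: "eps > 0" and sol: "solves_Nstar N R g A B p q eps U U'"
begin

lemma U_deriv_within: "r \<in> {0..R} \<Longrightarrow> (U has_real_derivative U' r) (at r within {0..R})"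
  using sol unfolding solves_Nstar_def by blast

lemma U_cont: "continuous_on {0..R} U"
  using U_deriv_within by (meson DERIV_continuous_on)

lemma U'_cont: "continuous_on {0..R} U'"
  using sol unfolding solves_Nstar_def by blast

lemma U_deriv: "0 < r \<Longrightarrow> r < R \<Longrightarrow> (U has_real_derivative U' r) (at r)"
  using U_deriv_within[of r] by (simp add: at_within_Icc_at)

lemmas U'_deriv = solves_Nstar_deriv[OF sol]

lemma nstar_rhs_eq: "nstar_rhs N R A B p q U r = - net U r"
  unfolding nstar_rhs_def net_def E_def P_def coefA_def coefB_def by (simp add: right_diff_distrib)

lemma ode:
  "0 < r \<Longrightarrow> r < R \<Longrightarrow>
   eps\<^sup>2 * g r * (deriv U' r + ((real N - 1) / r + deriv g r / g r) * U' r) = - net U r"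
  using sol unfolding solves_Nstar_def nstar_rhs_eq by auto

lemma mean_zero: "integral {0..R} (\<lambda>s. s ^ (N - 1) * U s) = 0"
  using sol unfolding solves_Nstar_def by blast

lemma W_0: "W U' 0 = 0"
  using N_facts by (simp add: W_def power_0_left)

lemma W_R: "eps\<^sup>2 * W U' R = flux"
proof -
  have "U' R = R * (A - B) / (eps\<^sup>2 * real N * g R)"
    using sol unfolding solves_Nstar_def by blast
  then have "eps\<^sup>2 * g R * U' R = R * (A - B) / real N"
    using g_pos[of R] R eps by simp
  moreover have "eps\<^sup>2 * W U' R = - (R ^ (N - 1) * (eps\<^sup>2 * g R * U' R))"
    unfolding W_def by simp
  moreover have "- (R ^ (N - 1) * (R * (A - B) / real N)) = R ^ (N - 1) * (R * (B - A) / real N)"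
    by (simp add: algebra_simps diff_divide_distrib)
  ultimately have "eps\<^sup>2 * W U' R = R ^ (N - 1) * (R * (B - A) / real N)" by metis
  then show ?thesis
    unfolding flux_def using N_facts(1) by (metis mult.assoc times_divide_eq_right)
qed

lemma W_cont: "continuous_on {0..R} (W U')"
  unfolding W_def by (intro continuous_intros g_cont U'_cont)

text \<open>The sum (N-1)/r + g'/g is the logarithmic derivative of r^(N-1) g, so after
  multiplication by r^(N-1) the left side of the equation becomes \<open>- eps\<^sup>2\<close> times
  the derivative of \<open>W\<close>.\<close>

lemma W_deriv:
  assumes r: "0 < r" "r < R"
  shows "(W U' has_real_derivative r ^ (N - 1) * net U r / eps\<^sup>2) (at r)"
proof -
  have g: "g r > 0" using g_pos r by auto
  \<comment> \<open>One power of \<open>r\<close> is split off to cancel the denominator in (N-1)/r;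
    \<open>N \<ge> 2\<close> makes the truncated subtraction harmless.\<close>
  have pw: "r ^ (N - 1) = r ^ (N - 1 - Suc 0) * r"
    using N_facts by (metis Suc_pred' One_nat_def power_Suc2)
  have "net U r / eps\<^sup>2 = - g r * (deriv U' r + ((real N - 1) / r + deriv g r / g r) * U' r)"
  proof -
    have "net U r = eps\<^sup>2 * (- g r * (deriv U' r + ((real N - 1) / r + deriv g r / g r) * U' r))"
      using ode[OF r] by (simp add: mult.assoc)
    then show ?thesis using eps by simp
  qed
  then have "r ^ (N - 1) * net U r / eps\<^sup>2
      = r ^ (N - 1) * (- g r * (deriv U' r + ((real N - 1) / r + deriv g r / g r) * U' r))"
    by (metis times_divide_eq_right)
  also have "\<dots> = - ((real (N - 1) * r ^ (N - 1 - Suc 0)) * (g r * U' r)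
      + r ^ (N - 1) * (deriv g r * U' r + g r * deriv U' r))"
    using r g N_facts unfolding pw by (simp add: field_simps of_nat_diff)
  finally have eq: "r ^ (N - 1) * net U r / eps\<^sup>2 = \<dots>" .
  have W_eq: "W U' = (\<lambda>r. - (r ^ (N - 1) * (g r * U' r)))"
    by (auto simp: W_def)
  show ?thesis
    unfolding eq W_eq
    by (rule derivative_eq_intros U'_deriv g_deriv refl r)+ (simp add: algebra_simps)
qed

lemma net_cont: "continuous_on {0..R} (net U)"
  unfolding net_def E_def P_def by (intro continuous_intros U_cont)

lemma E_deriv: "0 < r \<Longrightarrow> r < R \<Longrightarrow> (E U has_real_derivative q * E U r * - U' r) (at r)"
proof -
  assume r: "0 < r" "r < R"
  have "E U = (\<lambda>r. coefB U * exp (- q * U r))" by (auto simp: E_def)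
  then show ?thesis
    by (auto intro!: derivative_eq_intros U_deriv r)
qed

lemma P_deriv: "0 < r \<Longrightarrow> r < R \<Longrightarrow> (P U has_real_derivative p * P U r * U' r) (at r)"
proof -
  assume r: "0 < r" "r < R"
  have "P U = (\<lambda>r. coefA U * exp (p * U r))" by (auto simp: P_def)
  then show ?thesis
    by (auto intro!: derivative_eq_intros U_deriv r)
qed

lemma net_deriv:
  assumes "0 < r" "r < R"
  shows "(net U has_real_derivative (q * E U r + p * P U r) * - U' r) (at r)"
proof -
  have "net U = (\<lambda>r. E U r - P U r)" by (auto simp: net_def)
  then show ?thesis
    by (auto intro!: derivative_eq_intros E_deriv P_deriv assms simp: algebra_simps)
qed

lemma H_deriv:
  assumes "0 < r" "r < R"
  shows "(H U has_real_derivative - U' r * net U r) (at r)"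
proof -
  have "H U = (\<lambda>r. E U r / q + P U r / p)" by (auto simp: H_def)
  then show ?thesis
    using p q
    by (auto intro!: derivative_eq_intros E_deriv P_deriv assms simp: algebra_simps net_def)
qed

text \<open>Jensen's inequality in tangent-line form: integrated against the weight s^(N-1), the
  linear term drops out by the mean-zero condition. With \<open>1 + x \<le> exp x\<close> it bounds
  the denominators of both nonlocal coefficients from below.\<close>

lemma weight_ineq:
  assumes "continuous_on {0..R} f" "\<And>s. s \<in> {0..R} \<Longrightarrow> 1 + c * U s \<le> f s"
  shows "R ^ N / real N \<le> integral {0..R} (\<lambda>s. s ^ (N - 1) * f s)"
proof -
  have 1: "((\<lambda>s. s ^ (N - 1) * U s) has_integral 0) {0..R}"
  proof -
    have "(\<lambda>s. s ^ (N - 1) * U s) integrable_on {0..R}"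
      by (intro integrable_continuous_interval continuous_intros U_cont)
    from integrable_integral[OF this] show ?thesis unfolding mean_zero .
  qed
  have "((\<lambda>s. s ^ (N - 1) + c * (s ^ (N - 1) * U s)) has_integral (R ^ N / real N + c * 0)) {0..R}"
    by (intro has_integral_add integral_weight has_integral_mult_right 1)
  then have "R ^ N / real N + c * 0 \<le> integral {0..R} (\<lambda>s. s ^ (N - 1) * f s)"
  proof (rule has_integral_le)
    show "((\<lambda>s. s ^ (N - 1) * f s) has_integral integral {0..R} (\<lambda>s. s ^ (N - 1) * f s)) {0..R}"
      by (intro integrable_integral integrable_continuous_interval continuous_intros assms)
    fix x assume "x \<in> {0..R}"
    then show "x ^ (N - 1) + c * (x ^ (N - 1) * U x) \<le> x ^ (N - 1) * f x"
      using mult_left_mono[OF assms(2)[of x], of "x ^ (N - 1)"] by (auto simp: algebra_simps)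
  qed
  then show ?thesis by simp
qed

lemma exp_pU_integral_ge: "R ^ N / real N \<le> integral {0..R} (\<lambda>s. s ^ (N - 1) * exp (p * U s))"
  by (rule weight_ineq[where c = p]) (auto intro!: continuous_intros U_cont)

lemma exp_qU_integral_ge: "R ^ N / real N \<le> integral {0..R} (\<lambda>s. s ^ (N - 1) * exp (- q * U s))"
proof (rule weight_ineq[where c = "- q"])
  show "continuous_on {0..R} (\<lambda>s. exp (- q * U s))"
    by (intro continuous_intros U_cont)
qed (use exp_ge_add_one_self in blast)

lemma weight_total_pos: "R ^ N / real N > 0"
  using R N_facts by auto

lemma coefA_pos: "coefA U > 0" and coefA_le: "coefA U \<le> A"
proof -
  show "coefA U > 0"
    unfolding coefA_def using exp_pU_integral_ge weight_total_pos A by (smt (verit) divide_pos_pos mult_pos_pos)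
  have "R ^ N / real N * A / integral {0..R} (\<lambda>s. s ^ (N - 1) * exp (p * U s))
      \<le> R ^ N / real N * A / (R ^ N / real N)"
    using exp_pU_integral_ge weight_total_pos A by (intro divide_left_mono mult_nonneg_nonneg mult_pos_pos) auto
  then show "coefA U \<le> A"
    using weight_total_pos unfolding coefA_def by (metis less_irrefl nonzero_mult_div_cancel_left)
qed

lemma coefB_pos: "coefB U > 0" and coefB_le: "coefB U \<le> B"
proof -
  show "coefB U > 0"
    unfolding coefB_def using exp_qU_integral_ge weight_total_pos B by (smt (verit) divide_pos_pos mult_pos_pos)
  have "R ^ N / real N * B / integral {0..R} (\<lambda>s. s ^ (N - 1) * exp (- q * U s))
      \<le> R ^ N / real N * B / (R ^ N / real N)"
    using exp_qU_integral_ge weight_total_pos B by (intro divide_left_mono mult_nonneg_nonneg mult_pos_pos) auto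
  then show "coefB U \<le> B"
    using weight_total_pos unfolding coefB_def by (metis less_irrefl nonzero_mult_div_cancel_left)
qed

section \<open>Signs, monotonicity and bounds uniform in the parameter\<close>

lemma E_pos: "E U r > 0" and P_pos: "P U r > 0"
  using coefA_pos coefB_pos unfolding E_def P_def by auto

text \<open>At an interior negative minimum of the flux the density vanishes while \<open>U\<close> increases, so the
  density, and with it the slope of the flux, is negative immediately to the right.\<close>

lemma W_nonneg: "r \<in> {0..R} \<Longrightarrow> W U' r \<ge> 0"
proof -
  assume r: "r \<in> {0..R}"
  obtain x where x: "x \<in> {0..R}" "\<And>y. y \<in> {0..R} \<Longrightarrow> W U' x \<le> W U' y"
    using continuous_attains_inf[OF _ _ W_cont] R by auto
  have "W U' x \<ge> 0"
  proof (rule ccontr)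
    assume neg: "\<not> W U' x \<ge> 0"
    have WR: "W U' R > 0"
      using W_R flux_pos eps by (smt (verit) mult_nonneg_nonpos zero_le_power2)
    have xi: "0 < x" "x < R"
      using x(1) neg W_0 WR by (auto simp: less_le)
    have xN: "x ^ (N - 1) > 0" using xi by auto
    have "x ^ (N - 1) * net U x / eps\<^sup>2 = 0"
    proof (rule DERIV_local_min[OF W_deriv[OF xi]])
      show "0 < min x (R - x)" using xi by auto
      show "\<forall>y. \<bar>x - y\<bar> < min x (R - x) \<longrightarrow> W U' x \<le> W U' y"
        by (auto intro!: x(2))
    qed
    then have n0: "net U x = 0" using xN eps by (metis divide_eq_0_iff less_irrefl mult_eq_0_iff power2_eq_square)
    have "U' x > 0"
    proof -
      have "x ^ (N - 1) * g x * U' x > 0" using neg by (simp add: W_def)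
      then show ?thesis
        using xN g_pos[of x] x(1) by (metis mult_pos_pos zero_less_mult_pos)
    qed
    then have "(q * E U x + p * P U x) * - U' x < 0"
      using E_pos[of x] P_pos[of x] p q by (simp add: add_pos_pos)
    from DERIV_neg_dec_right[OF net_deriv[OF xi] this]
    obtain d where d: "d > 0" "\<And>h. 0 < h \<Longrightarrow> h < d \<Longrightarrow> net U (x + h) < 0"
      using n0 by auto
    define y where "y = x + min d (R - x) / 2"
    have y: "x < y" "y < R" "y < x + d"
      unfolding y_def using d(1) xi by (auto simp: min_def field_simps)
    have "W U' y < W U' x"
    proof (rule DERIV_neg_imp_decreasing_open[OF y(1)])
      fix z assume z: "x < z" "z < y"
      have "net U z < 0" using d(2)[of "z - x"] z y by auto
      moreover have "z ^ (N - 1) > 0" using z xi by auto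
      ultimately have "z ^ (N - 1) * net U z / eps\<^sup>2 < 0"
        using eps by (simp add: divide_neg_pos mult_pos_neg)
      then show "\<exists>D. (W U' has_real_derivative D) (at z) \<and> D < 0"
        using W_deriv[of z] z y xi by (meson order.strict_trans)
    qed (use W_cont xi y in \<open>auto intro: continuous_on_subset\<close>)
    then show False using x(2)[of y] y xi by auto
  qed
  then show ?thesis using x(2)[OF r] by linarith
qed

lemma U'_eq: "0 < r \<Longrightarrow> r \<le> R \<Longrightarrow> - U' r = W U' r / (r ^ (N - 1) * g r)"
  unfolding W_def using g_pos[of r] by (simp add: field_simps)

lemma U'_nonpos: "0 < r \<Longrightarrow> r \<le> R \<Longrightarrow> U' r \<le> 0"
  using U'_eq[of r] W_nonneg[of r] g_pos[of r] by (smt (verit) atLeastAtMost_iff divide_nonneg_pos mult_pos_pos zero_less_power)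

lemma U_antimono: "0 \<le> r \<Longrightarrow> r \<le> s \<Longrightarrow> s \<le> R \<Longrightarrow> U s \<le> U r"
proof -
  assume rs: "0 \<le> r" "r \<le> s" "s \<le> R"
  show ?thesis
  proof (rule DERIV_nonpos_imp_decreasing_open[OF rs(2)])
    fix x assume "r < x" "x < s"
    then show "\<exists>y. (U has_real_derivative y) (at x) \<and> y \<le> 0"
      using U_deriv[of x] U'_nonpos[of x] rs by auto
  qed (use U_cont rs in \<open>auto intro: continuous_on_subset\<close>)
qed

lemma E_mono: "0 \<le> r \<Longrightarrow> r \<le> s \<Longrightarrow> s \<le> R \<Longrightarrow> E U r \<le> E U s"
  unfolding E_def using U_antimono[of r s] coefB_pos q by auto

lemma P_antimono: "0 \<le> r \<Longrightarrow> r \<le> s \<Longrightarrow> s \<le> R \<Longrightarrow> P U s \<le> P U r"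
  unfolding P_def using U_antimono[of r s] coefA_pos p by auto

lemma net_mono: "0 \<le> r \<Longrightarrow> r \<le> s \<Longrightarrow> s \<le> R \<Longrightarrow> net U r \<le> net U s"
  unfolding net_def using E_mono[of r s] P_antimono[of r s] by linarith

text \<open>The density is nondecreasing, so a negative value at \<open>x\<close> would make it
  negative on all of (0, x). Then \<open>W\<close> would decrease strictly from
  \<open>W U' 0 = 0\<close>, against \<open>W_nonneg\<close>.\<close>

lemma net_nonneg: "r \<in> {0..R} \<Longrightarrow> net U r \<ge> 0"
proof -
  have int: "net U x \<ge> 0" if x: "0 < x" "x < R" for x
  proof (rule ccontr)
    assume neg: "\<not> net U x \<ge> 0"
    have "W U' x < W U' 0"
    proof (rule DERIV_neg_imp_decreasing_open[OF x(1)])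
      fix z assume z: "0 < z" "z < x"
      have "net U z < 0" using net_mono[of z x] z x neg by auto
      moreover have "z ^ (N - 1) > 0" using z by auto
      ultimately have "z ^ (N - 1) * net U z / eps\<^sup>2 < 0"
        using eps by (simp add: divide_neg_pos mult_pos_neg)
      then show "\<exists>D. (W U' has_real_derivative D) (at z) \<and> D < 0"
        using W_deriv[of z] z x by (meson order.strict_trans)
    qed (use W_cont x in \<open>auto intro: continuous_on_subset\<close>)
    then show False using W_0 W_nonneg[of x] x by auto
  qed
  assume r: "r \<in> {0..R}"
  show ?thesis
  \<comment> \<open>The argument through \<open>W_deriv\<close> works at interior points; continuity
    adds both endpoints.\<close>
  proof (rule continuous_ge_on_closure[where S = "{0<..<R}" and f = "net U"])
    show "continuous_on (closure {0<..<R}) (net U)" using net_cont R by simp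
  qed (use r R int in auto)
qed

text \<open>Since \<open>U\<close> is largest at the origin, the denominator of
  \<open>coefA U\<close> is at most the total weight times \<open>exp (p * U 0)\<close>, and this
  exponential cancels in \<open>P U 0\<close>. It starts the chain from \<open>A\<close> through
  \<open>P U 0\<close> and \<open>E U 0\<close> to \<open>E U r\<close>.\<close>

lemma A_le_P0: "A \<le> P U 0"
proof -
  have "integral {0..R} (\<lambda>s. s ^ (N - 1) * exp (p * U s)) \<le> integral {0..R} (\<lambda>s. s ^ (N - 1) * exp (p * U 0))"
    using U_antimono[of 0] p
    by (intro integral_le integrable_continuous_interval continuous_intros U_cont mult_left_mono) auto
  also have "\<dots> = R ^ N / real N * exp (p * U 0)"
    using has_integral_mult_left[OF integral_weight] by (rule integral_unique)
  finally have "integral {0..R} (\<lambda>s. s ^ (N - 1) * exp (p * U s)) \<le> R ^ N / real N * exp (p * U 0)"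
    (is "?I \<le> _") .
  then have "A * ?I \<le> A * (R ^ N / real N * exp (p * U 0))" using A by (intro mult_left_mono) auto
  moreover have "?I > 0" using exp_pU_integral_ge weight_total_pos by linarith
  ultimately show ?thesis
    unfolding P_def coefA_def
    by (metis (no_types, lifting) mult.assoc mult.commute pos_le_divide_eq times_divide_eq_left)
qed

lemma P0_le_E0: "P U 0 \<le> E U 0"
  using net_nonneg[of 0] R by (simp add: net_def)

lemma U0_nonneg: "U 0 \<ge> 0"
proof -
  have "0 = integral {0..R} (\<lambda>s. s ^ (N - 1) * U s)" using mean_zero by simp
  also have "\<dots> \<le> integral {0..R} (\<lambda>s. s ^ (N - 1) * U 0)"
    using U_antimono[of 0]
    by (intro integral_le integrable_continuous_interval continuous_intros U_cont mult_left_mono) auto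
  also have "\<dots> = R ^ N / real N * U 0"
    using has_integral_mult_left[OF integral_weight] by (rule integral_unique)
  finally show ?thesis using weight_total_pos by (metis zero_le_mult_iff not_le)
qed

lemma E_ge: "0 \<le> r \<Longrightarrow> r \<le> R \<Longrightarrow> A \<le> E U r"
  using A_le_P0 P0_le_E0 E_mono[of 0 r] by linarith

text \<open>As \<open>U 0\<close> is nonnegative, the exponential in \<open>E U 0\<close> is at most
  1, and \<open>A \<le> E U 0\<close> passes to the coefficient.\<close>

lemma coefB_ge: "A \<le> coefB U"
proof -
  have "E U 0 \<le> coefB U" unfolding E_def using U0_nonneg q coefB_pos by auto
  then show ?thesis using E_ge[of 0] R by auto
qed

lemma U0_le: "U 0 \<le> umax"
proof -
  have "A \<le> B * exp (- q * U 0)"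
    using E_ge[of 0] R coefB_le unfolding E_def by (smt (verit) exp_ge_zero mult_right_mono)
  then have "exp (q * U 0) \<le> B / A" using A by (simp add: exp_minus field_simps)
  then have "q * U 0 \<le> ln (B / A)" using A B by (metis exp_gt_zero ln_exp ln_le_cancel_iff divide_pos_pos)
  then show ?thesis unfolding umax_def using q by (simp add: field_simps)
qed

lemma U_le: "0 \<le> r \<Longrightarrow> r \<le> R \<Longrightarrow> U r \<le> U 0"
  using U_antimono[of 0 r] by auto

lemma coefA_ge: "A * exp (- p * U 0) \<le> coefA U"
  using A_le_P0 unfolding P_def by (simp add: exp_minus field_simps)

lemma P_le: "0 \<le> r \<Longrightarrow> r \<le> R \<Longrightarrow> P U r \<le> Pmax"
  unfolding P_def Pmax_def using coefA_le coefA_pos U_le[of r] U0_le p by (intro mult_mono) auto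

section \<open>Coercivity, exponential decay and integrated identities\<close>

lemma slope_le: "slope \<le> q * E U r + p * P U r"
proof (cases "U r \<le> 0")
  case True
  then have "A * 1 \<le> E U r"
    unfolding E_def using coefB_ge A q by (intro mult_mono) (auto simp: mult_nonneg_nonpos)
  then have "q * A \<le> q * E U r" using q by auto
  moreover have "p * P U r > 0" using p P_pos by auto
  ultimately show ?thesis unfolding slope_def by (simp add: mult.commute)
next
  case False
  have "A * exp (- p * umax) \<le> A * exp (- p * U 0)" using U0_le p A by auto
  then have "A * exp (- p * umax) \<le> coefA U" using coefA_ge by linarith
  also have "coefA U * 1 \<le> P U r" unfolding P_def using False coefA_pos p by (intro mult_left_mono) auto
  finally have "p * (A * exp (- p * umax)) \<le> p * P U r" using p by auto
  moreover have "q * E U r > 0" using q E_pos by auto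
  ultimately show ?thesis unfolding slope_def by (simp add: mult.assoc)
qed

text \<open>\<open>net U + slope * U\<close> is nondecreasing, because its derivative is
  \<open>- U'\<close> times the nonnegative quantity in \<open>slope_le\<close>. Smallness of the
  density thus limits the total drop of \<open>U\<close> from the origin.\<close>

lemma U_drop_le: "0 \<le> r \<Longrightarrow> r \<le> R \<Longrightarrow> U 0 - U r \<le> net U r / slope"
proof -
  assume r: "0 \<le> r" "r \<le> R"
  have "net U 0 + slope * U 0 \<le> net U r + slope * U r"
  proof (rule DERIV_nonneg_imp_increasing_open[OF r(1), of "\<lambda>r. net U r + slope * U r"])
    fix x assume x: "0 < x" "x < r"
    have "((\<lambda>r. net U r + slope * U r) has_real_derivative
        (q * E U x + p * P U x) * - U' x + slope * U' x) (at x)"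
      using x r by (auto intro!: derivative_eq_intros net_deriv U_deriv)
    moreover have "(q * E U x + p * P U x) * - U' x + slope * U' x
        = (q * E U x + p * P U x - slope) * - U' x" by (simp add: algebra_simps)
    moreover have "\<dots> \<ge> 0" using slope_le[of x] U'_nonpos[of x] x r by (intro mult_nonneg_nonneg) auto
    ultimately show "\<exists>y. ((\<lambda>r. net U r + slope * U r) has_real_derivative y) (at x) \<and> 0 \<le> y"
      by metis
  next
    have "continuous_on {0..R} (\<lambda>r. net U r + slope * U r)"
      by (intro continuous_intros net_cont U_cont)
    then show "continuous_on {0..r} (\<lambda>r. net U r + slope * U r)"
      using r by (auto intro: continuous_on_subset)
  qed
  then have "slope * (U 0 - U r) \<le> net U r" using net_nonneg[of 0] R by (simp add: algebra_simps)
  then show ?thesis using slope_pos by (simp add: field_simps)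
qed

text \<open>The squares of \<open>net U\<close> and of \<open>eps * W\<close> have derivatives
  sharing the factor \<open>2 * net U\<close>. The remaining factors are comparable, since
  \<open>W\<close> is \<open>- U'\<close> times r^(N-1) g and \<open>gap\<close> was normalised for
  this weight. At the origin \<open>W\<close> vanishes, so the difference of squares starts
  nonnegative.\<close>

lemma net_ge_W: "0 \<le> r \<Longrightarrow> r \<le> R \<Longrightarrow> sqrt gap * eps * W U' r \<le> net U r"
proof -
  assume r: "0 \<le> r" "r \<le> R"
  let ?f = "\<lambda>r. (net U r)\<^sup>2 - gap * eps\<^sup>2 * (W U' r)\<^sup>2"
  have "?f 0 \<le> ?f r"
  proof (rule DERIV_nonneg_imp_increasing_open[OF r(1)])
    fix x assume x: "0 < x" "x < r"
    let ?D = "2 * net U x * ((q * E U x + p * P U x) * - U' x)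
        - gap * eps\<^sup>2 * (2 * W U' x * (x ^ (N - 1) * net U x / eps\<^sup>2))"
    have D: "(?f has_real_derivative ?D) (at x)"
      using x r eps by (auto intro!: derivative_eq_intros net_deriv W_deriv)
    have xN: "0 < x ^ (N - 1)" "x ^ (N - 1) \<le> R ^ (N - 1)" using x r by (auto intro: power_mono)
    have gx: "0 < g x" "g x \<le> gu" using glu[of x] gl x r by auto
    have "gap * x ^ (N - 1) * (x ^ (N - 1) * g x) = gap * (((x ^ (N - 1))\<^sup>2) * g x)"
      by (simp add: power2_eq_square)
    also have "\<dots> \<le> gap * ((R ^ (N - 1))\<^sup>2 * gu)"
      using xN gx gap_pos by (intro mult_left_mono mult_mono power_mono[of _ _ 2]) auto
    also have "\<dots> = slope" unfolding gap_def using gu R by simp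
    finally have "gap * x ^ (N - 1) * (x ^ (N - 1) * g x) \<le> q * E U x + p * P U x"
      using slope_le[of x] by linarith
    then have "gap * x ^ (N - 1) * (x ^ (N - 1) * g x) * - U' x \<le> (q * E U x + p * P U x) * - U' x"
      using U'_nonpos[of x] x r by (intro mult_right_mono) auto
    then have *: "gap * x ^ (N - 1) * W U' x \<le> (q * E U x + p * P U x) * - U' x"
      by (simp add: W_def algebra_simps)
    have "?D = 2 * net U x * ((q * E U x + p * P U x) * - U' x - gap * x ^ (N - 1) * W U' x)"
      using eps by (simp add: algebra_simps)
    also have "\<dots> \<ge> 0" using net_nonneg[of x] x r * by (intro mult_nonneg_nonneg) auto
    finally show "\<exists>y. (?f has_real_derivative y) (at x) \<and> 0 \<le> y" using D by blast
  next
    have "continuous_on {0..R} ?f"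
      by (intro continuous_intros net_cont W_cont)
    then show "continuous_on {0..r} ?f"
      using r by (auto intro: continuous_on_subset)
  qed
  then have "(net U 0)\<^sup>2 \<le> ?f r"
    using W_0 by simp
  then have "gap * eps\<^sup>2 * (W U' r)\<^sup>2 \<le> (net U r)\<^sup>2"
    using zero_le_power2[of "net U 0"] by linarith
  moreover have "(sqrt gap * eps * W U' r)\<^sup>2 = gap * eps\<^sup>2 * (W U' r)\<^sup>2"
    using gap_pos by (simp add: power_mult_distrib)
  ultimately show ?thesis
    using net_nonneg[of r] r by (metis atLeastAtMost_iff power2_le_imp_le)
qed

text \<open>\<open>net_ge_W\<close> turns the flux equation into the differential inequality W' >=
  (sqrt gap / eps) r^(N-1) W. Its integrating factor is \<open>exp (- c * r ^ N)\<close>, and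
  comparison with \<open>r = R\<close> gives decay away from the boundary.\<close>

lemma W_decay:
  assumes r: "0 \<le> r" "r \<le> R"
  shows "eps\<^sup>2 * W U' r \<le> flux * exp (- rate * (R - r) / eps)"
proof -
  define c where "c = sqrt gap / (real N * eps)"
  have c: "c > 0" unfolding c_def using gap_pos eps N_facts by auto
  let ?f = "\<lambda>r. W U' r * exp (- c * r ^ N)"
  have "?f r \<le> ?f R"
  proof (rule DERIV_nonneg_imp_increasing_open[OF r(2)])
    fix x assume x: "r < x" "x < R"
    let ?D = "x ^ (N - 1) * net U x / eps\<^sup>2 * exp (- c * x ^ N)
       + W U' x * (exp (- c * x ^ N) * (- c * (real N * x ^ (N - 1))))"
    have D: "(?f has_real_derivative ?D) (at x)"
      using x r eps by (auto intro!: derivative_eq_intros W_deriv)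
    have "?D = x ^ (N - 1) * exp (- c * x ^ N) / eps\<^sup>2 * (net U x - sqrt gap * eps * W U' x)"
      unfolding c_def using eps N_facts(3) by (simp add: field_simps power2_eq_square)
    also have "\<dots> \<ge> 0"
      using net_ge_W[of x] x r by (intro mult_nonneg_nonneg) auto
    finally show "\<exists>y. (?f has_real_derivative y) (at x) \<and> 0 \<le> y" using D by blast
  next
    have "continuous_on {0..R} ?f"
      by (intro continuous_intros W_cont)
    then show "continuous_on {r..R} ?f"
      using r by (auto intro: continuous_on_subset)
  qed
  then have "?f r * exp (c * r ^ N) \<le> ?f R * exp (c * r ^ N)" by simp
  then have 1: "W U' r \<le> W U' R * exp (- c * (R ^ N - r ^ N))"
    by (simp add: algebra_simps flip: exp_add)
  \<comment> \<open>Bounding r^(N-1) by R^(N-1) trades the difference of N-th powers for the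
    distance to the boundary.\<close>
  have "r ^ N = r ^ (N - 1) * r" using N_facts by (metis power_minus_mult)
  also have "\<dots> \<le> R ^ (N - 1) * r" using r by (intro mult_right_mono power_mono) auto
  finally have "R ^ (N - 1) * (R - r) \<le> R ^ N - r ^ N" using N_facts(1) by (simp add: algebra_simps)
  then have "c * (R ^ (N - 1) * (R - r)) \<le> c * (R ^ N - r ^ N)" using c by auto
  moreover have "c * (R ^ (N - 1) * (R - r)) = rate * (R - r) / eps"
    unfolding c_def rate_def by (simp add: field_simps)
  ultimately have 2: "exp (- c * (R ^ N - r ^ N)) \<le> exp (- rate * (R - r) / eps)" by simp
  have "eps\<^sup>2 * W U' r \<le> eps\<^sup>2 * (W U' R * exp (- c * (R ^ N - r ^ N)))"
    using 1 by (intro mult_left_mono) auto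
  also have "\<dots> = flux * exp (- c * (R ^ N - r ^ N))" using W_R by (metis mult.assoc)
  also have "\<dots> \<le> flux * exp (- rate * (R - r) / eps)" using 2 flux_pos by auto
  finally show ?thesis .
qed

text \<open>The product r^(N-1) \<open>net U\<close> is nondecreasing, so over a step of length
  \<open>h\<close> the scaled flux gains at least \<open>h\<close> times its initial value. This
  recovers a pointwise bound on the density from one on the flux.\<close>

lemma net_step:
  assumes r: "0 \<le> r" "0 \<le> h" "r + h \<le> R"
  shows "r ^ (N - 1) * h * net U r \<le> eps\<^sup>2 * W U' (r + h)"
proof -
  let ?f = "\<lambda>s. eps\<^sup>2 * W U' s - r ^ (N - 1) * net U r * s"
  have "?f r \<le> ?f (r + h)"
  proof (rule DERIV_nonneg_imp_increasing_open[of r "r + h" ?f])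
    fix x assume x: "r < x" "x < r + h"
    have D: "(?f has_real_derivative eps\<^sup>2 * (x ^ (N - 1) * net U x / eps\<^sup>2) - r ^ (N - 1) * net U r) (at x)"
      using x r eps by (auto intro!: derivative_eq_intros W_deriv)
    have "r ^ (N - 1) * net U r \<le> x ^ (N - 1) * net U x"
      using x r net_mono[of r x] net_nonneg[of r] by (intro mult_mono power_mono) auto
    then show "\<exists>y. (?f has_real_derivative y) (at x) \<and> 0 \<le> y" 
      using D eps by (intro exI[of _ "eps\<^sup>2 * (x ^ (N - 1) * net U x / eps\<^sup>2) - r ^ (N - 1) * net U r"]) auto
  next
    have "continuous_on {0..R} ?f"
      by (intro continuous_intros W_cont)
    then show "continuous_on {r..r+h} ?f"
      using r by (auto intro: continuous_on_subset)
  qed (use r in auto)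
  moreover have "eps\<^sup>2 * W U' r \<ge> 0" using W_nonneg[of r] r by auto
  ultimately show ?thesis by (simp add: algebra_simps)
qed

text \<open>\<open>net_step\<close> is used with half the distance to the boundary. The flux at that
  midpoint still decays by \<open>W_decay\<close>, at the price of half the exponent.\<close>

lemma net_decay:
  assumes r: "R / 2 \<le> r" "r < R"
  shows "net U r \<le> 2 * flux / ((R / 2) ^ (N - 1) * (R - r)) * exp (- rate * (R - r) / (2 * eps))"
proof -
  let ?h = "(R - r) / 2"
  have r0: "r > 0" using r R by linarith
  have rh: "0 \<le> r + ?h" "r + ?h \<le> R" using r r0 by (auto simp: field_simps)
  have "(R / 2) ^ (N - 1) * ?h * net U r \<le> r ^ (N - 1) * ?h * net U r"
    using r R r0 net_nonneg[of r] by (intro mult_right_mono power_mono) auto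
  also have "\<dots> \<le> eps\<^sup>2 * W U' (r + ?h)" using net_step[of r ?h] r r0 by (simp add: field_simps)
  also have "\<dots> \<le> flux * exp (- rate * (R - (r + ?h)) / eps)" using W_decay[OF rh] .
  also have "- rate * (R - (r + ?h)) / eps = - rate * (R - r) / (2 * eps)" using eps by (simp add: field_simps)
  finally have "(R / 2) ^ (N - 1) * (R - r) * net U r \<le> 2 * flux * exp (- rate * (R - r) / (2 * eps))"
    by (simp add: mult.assoc)
  moreover have "(R / 2) ^ (N - 1) * (R - r) > 0" using r R by auto
  ultimately show ?thesis by (simp add: field_simps)
qed

text \<open>The first integral: the derivative of \<open>eps\<^sup>2 / 2 * W\<^sup>2\<close> is the
  weight r^(2N-2) g times the derivative of \<open>H\<close>. The latter,
  \<open>- U' * net U\<close>, is nonnegative, so the weight may be frozen at a lower bound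
  \<open>k1\<close> or an upper bound \<open>k2\<close>.\<close>

lemma energy:
  assumes rs: "0 < r" "r \<le> s" "s \<le> R"
    and k: "\<And>x. x \<in> {r..s} \<Longrightarrow> k1 \<le> (x ^ (N - 1))\<^sup>2 * g x \<and> (x ^ (N - 1))\<^sup>2 * g x \<le> k2"
  shows "k1 * (H U s - H U r) \<le> eps\<^sup>2 / 2 * ((W U' s)\<^sup>2 - (W U' r)\<^sup>2)"
    and "eps\<^sup>2 / 2 * ((W U' s)\<^sup>2 - (W U' r)\<^sup>2) \<le> k2 * (H U s - H U r)"
proof -
  have H_cont: "continuous_on {0..R} (H U)"
    unfolding H_def E_def P_def using p q by (intro continuous_intros U_cont) auto
  have key: "eps\<^sup>2 / 2 * (2 * W U' x * (x ^ (N - 1) * net U x / eps\<^sup>2)) = (x ^ (N - 1))\<^sup>2 * g x * (- U' x * net U x)"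
    for x using eps by (simp add: W_def power2_eq_square)
  have nn: "- U' x * net U x \<ge> 0" if "r < x" "x < s" for x
    using U'_nonpos[of x] net_nonneg[of x] that rs by (intro mult_nonneg_nonneg) auto
  let ?f = "\<lambda>x. eps\<^sup>2 / 2 * (W U' x)\<^sup>2 - k1 * H U x"
  have "?f r \<le> ?f s"
  proof (rule DERIV_nonneg_imp_increasing_open[OF rs(2)])
    fix x assume x: "r < x" "x < s"
    let ?D = "eps\<^sup>2 / 2 * (2 * W U' x * (x ^ (N - 1) * net U x / eps\<^sup>2)) - k1 * (- U' x * net U x)"
    have D: "(?f has_real_derivative ?D) (at x)"
      using x rs by (auto intro!: derivative_eq_intros W_deriv H_deriv)
    have "?D = ((x ^ (N - 1))\<^sup>2 * g x - k1) * (- U' x * net U x)"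
      unfolding key by (simp add: algebra_simps)
    also have "\<dots> \<ge> 0" using nn[OF x] k[of x] x by (intro mult_nonneg_nonneg[OF _ nn]) auto
    finally show "\<exists>y. (?f has_real_derivative y) (at x) \<and> 0 \<le> y" using D by blast
  next
    have "continuous_on {0..R} ?f" by (intro continuous_intros W_cont H_cont)
    then show "continuous_on {r..s} ?f" using rs by (auto intro: continuous_on_subset)
  qed
  then show "k1 * (H U s - H U r) \<le> eps\<^sup>2 / 2 * ((W U' s)\<^sup>2 - (W U' r)\<^sup>2)"
    by (simp add: algebra_simps)
  let ?f = "\<lambda>x. k2 * H U x - eps\<^sup>2 / 2 * (W U' x)\<^sup>2"
  have "?f r \<le> ?f s"
  proof (rule DERIV_nonneg_imp_increasing_open[OF rs(2)])
    fix x assume x: "r < x" "x < s"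
    let ?D = "k2 * (- U' x * net U x) - eps\<^sup>2 / 2 * (2 * W U' x * (x ^ (N - 1) * net U x / eps\<^sup>2))"
    have D: "(?f has_real_derivative ?D) (at x)"
      using x rs by (auto intro!: derivative_eq_intros W_deriv H_deriv)
    have "?D = (k2 - (x ^ (N - 1))\<^sup>2 * g x) * (- U' x * net U x)"
      unfolding key by (simp add: algebra_simps)
    also have "\<dots> \<ge> 0" using nn[OF x] k[of x] x by (intro mult_nonneg_nonneg[OF _ nn]) auto
    finally show "\<exists>y. (?f has_real_derivative y) (at x) \<and> 0 \<le> y" using D by blast
  next
    have "continuous_on {0..R} ?f" by (intro continuous_intros W_cont H_cont)
    then show "continuous_on {r..s} ?f" using rs by (auto intro: continuous_on_subset)
  qed
  then show "eps\<^sup>2 / 2 * ((W U' s)\<^sup>2 - (W U' r)\<^sup>2) \<le> k2 * (H U s - H U r)"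
    by (simp add: algebra_simps)
qed

text \<open>The mean-zero integral is split at \<open>r\<close>, and \<open>U\<close> is replaced by
  its minimum on each piece. The outer piece carries weight at most R^(N-1) (R - r), so even a
  logarithmically large drop to \<open>U R\<close> costs little when \<open>r\<close> is close to
  \<open>R\<close>.\<close>

lemma U0_bound:
  assumes r: "0 \<le> r" "r \<le> R"
  shows "U 0 \<le> (U 0 - U r) + real N * (R - r) / R * (U 0 - U R)"
proof -
  have i: "(\<lambda>s. s ^ (N - 1) * U s) integrable_on S" if "S = {0..R} \<or> S = {0..r} \<or> S = {r..R}" for S
    using that r by (auto intro!: integrable_continuous_interval continuous_intros continuous_on_subset[OF U_cont])
  have w: "(\<lambda>s. s ^ (N - 1)) integrable_on {x..y}" for x y :: real
    by (intro integrable_continuous_interval continuous_intros)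
  have "integral {0..r} (\<lambda>s. s ^ (N - 1) * U s) \<ge> integral {0..r} (\<lambda>s. s ^ (N - 1) * U r)"
    using U_antimono r
    by (intro integral_le i mult_left_mono integrable_on_mult_left w) auto
  moreover have "integral {r..R} (\<lambda>s. s ^ (N - 1) * U s) \<ge> integral {r..R} (\<lambda>s. s ^ (N - 1) * U R)"
    using U_antimono r
    by (intro integral_le i mult_left_mono integrable_on_mult_left w) auto
  moreover have "integral {0..r} (\<lambda>s. s ^ (N - 1) * U s) + integral {r..R} (\<lambda>s. s ^ (N - 1) * U s) = 0"
    using Henstock_Kurzweil_Integration.integral_combine[OF r i] mean_zero by simp
  moreover define X where "X = integral {0..r} (\<lambda>s. s ^ (N - 1))"
  moreover define Y where "Y = integral {r..R} (\<lambda>s. s ^ (N - 1))"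
  ultimately have XYU: "X * U r + Y * U R \<le> 0" by simp
  have XY: "X + Y = R ^ N / real N"
    unfolding X_def Y_def
    using Henstock_Kurzweil_Integration.integral_combine[OF r w] integral_unique[OF integral_weight] by simp
  have "Y \<le> integral {r..R} (\<lambda>s. R ^ (N - 1))"
    unfolding Y_def using r by (intro integral_le w power_mono) auto
  then have Y: "Y \<le> R ^ (N - 1) * (R - r)" using r by (simp add: mult.commute)
  have X: "X \<ge> 0" unfolding X_def using r by (intro integral_nonneg w) auto
  have Y0: "Y \<ge> 0" unfolding Y_def using r by (intro integral_nonneg w) auto
  have dr: "U 0 - U r \<ge> 0" "U 0 - U R \<ge> 0" using U_le[of r] U_le[of R] r R by auto
  have "(X + Y) * U 0 \<le> X * (U 0 - U r) + Y * (U 0 - U R)"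
    using XYU by (simp add: algebra_simps)
  also have "\<dots> \<le> (X + Y) * (U 0 - U r) + (R ^ (N - 1) * (R - r)) * (U 0 - U R)"
    using X Y Y0 dr by (intro add_mono mult_right_mono) auto
  \<comment> \<open>The outer weight is expressed through the total weight R^N / N, which can then
    be cancelled.\<close>
  also have "R ^ (N - 1) * (R - r) = (X + Y) * (real N * (R - r) / R)"
    unfolding XY using R N_facts(3) N_facts(1)[symmetric] by (simp add: field_simps)
  finally have "(X + Y) * U 0 \<le> (X + Y) * (U 0 - U r) + (X + Y) * (real N * (R - r) / R) * (U 0 - U R)" .
  then have "(X + Y) * U 0 \<le> (X + Y) * ((U 0 - U r) + real N * (R - r) / R * (U 0 - U R))"
    by (simp only: distrib_left mult.assoc)
  then show ?thesis using weight_total_pos XY mult_le_cancel_left_pos by metis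
qed

text \<open>Differentiating 1 / sqrt E gives (q/2) U' / sqrt E, because E' = - q U' E. The mean
  value theorem thus expresses the growth of 1 / sqrt E away from the boundary through the quotient
  - U' / sqrt E, whose limit is found later.\<close>

lemma sigma_mvt:
  assumes r: "0 < r" "r \<le> R"
  shows "\<exists>z. r \<le> z \<and> z \<le> R \<and>
    1 / sqrt (E U r) - 1 / sqrt (E U R) = (R - r) * (q / 2) * (- U' z / sqrt (E U z))"
proof (cases "r = R")
  case True
  then show ?thesis by auto
next
  case False
  have E_cont: "continuous_on {0..R} (E U)"
    unfolding E_def by (intro continuous_intros U_cont)
  have nz: "\<And>x. E U x \<noteq> 0" using E_pos by (metis less_irrefl)
  have D: "((\<lambda>r. - (1 / sqrt (E U r))) has_real_derivative
      q * E U z * - U' z / (2 * sqrt (E U z)) / (sqrt (E U z) * sqrt (E U z))) (at z)"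
    if "r < z" "z < R" for z
    using that r E_pos[of z]
    by (auto intro!: derivative_eq_intros E_deriv simp: field_simps)
  have "\<exists>l z. r < z \<and> z < R \<and> ((\<lambda>r. - (1 / sqrt (E U r))) has_real_derivative l) (at z)
     \<and> - (1 / sqrt (E U R)) - - (1 / sqrt (E U r)) = (R - r) * l"
  proof (rule MVT)
    show "continuous_on {r..R} (\<lambda>r. - (1 / sqrt (E U r)))"
      using r nz by (intro continuous_intros continuous_on_subset[OF E_cont]) auto
    fix x assume x: "r < x" "x < R"
    show "(\<lambda>r. - (1 / sqrt (E U r))) differentiable at x"
      using D[OF x] real_differentiable_def by blast
  qed (use r False in auto)
  then obtain l z where z: "r < z" "z < R"
    and l: "((\<lambda>r. - (1 / sqrt (E U r))) has_real_derivative l) (at z)"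
    and eq: "- (1 / sqrt (E U R)) - - (1 / sqrt (E U r)) = (R - r) * l" by blast
  then have "l = q * E U z * - U' z / (2 * sqrt (E U z)) / (sqrt (E U z) * sqrt (E U z))"
    using l D[OF z] DERIV_unique by blast
  also have "\<dots> = (q / 2) * (- U' z / sqrt (E U z))"
    using E_pos[of z] by simp
  finally show ?thesis using z eq by (intro exI[of _ z]) auto
qed

end

section \<open>Bulk asymptotics\<close>

locale nstar_family = nstar_data +
  fixes U U' :: "real \<Rightarrow> real \<Rightarrow> real"
  assumes sols: "\<And>e. e > 0 \<Longrightarrow> solves_Nstar N R g A B p q e (U e) (U' e)"
begin

lemma solution_at: "e > 0 \<Longrightarrow> nstar_solution N R A B p q gl gu g e (U e) (U' e)"
  by (intro nstar_solution.intro nstar_data_axioms nstar_solution_axioms.intro sols)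

lemma eventually_eps_pos: "eventually (\<lambda>e. e > (0::real)) (at_right 0)"
  by (rule eventually_at_right_less)

lemma eventually_eps_less: "x > 0 \<Longrightarrow> eventually (\<lambda>e. e < (x::real)) (at_right 0)"
  by (auto simp: eventually_at_right_field)

lemma net_tendsto_0:
  assumes "0 < h" "h \<le> R / 2"
  shows "((\<lambda>e. net (U e) (R - h)) \<longlongrightarrow> 0) (at_right 0)"
proof (rule tendsto_sandwich)
  show "eventually (\<lambda>e. 0 \<le> net (U e) (R - h)) (at_right 0)"
    using eventually_eps_pos by eventually_elim (use nstar_solution.net_nonneg[OF solution_at] assms in auto)
  define K where "K = 2 * flux / ((R / 2) ^ (N - 1) * h)"
  define c where "c = rate * h / 2"
  have c: "c > 0" unfolding c_def using rate_pos assms by auto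
  show "eventually (\<lambda>e. net (U e) (R - h) \<le> K * exp (- c / e)) (at_right 0)"
    using eventually_eps_pos
  proof eventually_elim
    case (elim e)
    show ?case using nstar_solution.net_decay[OF solution_at[OF elim], of "R - h"] assms
      by (auto simp: K_def c_def)
  qed
  show "((\<lambda>e. K * exp (- c / e)) \<longlongrightarrow> 0) (at_right 0)"
    using c by real_asymp
qed simp

text \<open>At fixed distance from the boundary the exponential decay absorbs the factor 1 / e lost
  in passing from \<open>e\<^sup>2 * W\<close> to \<open>e * W\<close>.\<close>

lemma W_tendsto_0:
  assumes "0 < h" "h \<le> R"
  shows "((\<lambda>e. e * W (U' e) (R - h)) \<longlongrightarrow> 0) (at_right 0)"
proof (rule tendsto_sandwich)
  show "eventually (\<lambda>e. 0 \<le> e * W (U' e) (R - h)) (at_right 0)"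
    using eventually_eps_pos by eventually_elim (use nstar_solution.W_nonneg[OF solution_at] assms in auto)
  define c where "c = rate * h"
  have c: "c > 0" unfolding c_def using rate_pos assms by auto
  show "eventually (\<lambda>e. e * W (U' e) (R - h) \<le> flux * exp (- c / e) / e) (at_right 0)"
    using eventually_eps_pos
  proof eventually_elim
    case (elim e)
    have "e\<^sup>2 * W (U' e) (R - h) \<le> flux * exp (- c / e)"
      using nstar_solution.W_decay[OF solution_at[OF elim], of "R - h"] assms by (auto simp: c_def)
    then show ?case using elim by (simp add: field_simps power2_eq_square)
  qed
  show "((\<lambda>e. flux * exp (- c / e) / e) \<longlongrightarrow> 0) (at_right 0)"
    using c by real_asymp
qed simp

text \<open>Bounds \<open>H\<close> wherever the density is below 1, since \<open>E\<close> is then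
  at most \<open>1 + Pmax\<close>.\<close>

definition Hmax :: real where "Hmax = (1 + Pmax) / q + Pmax / p"

lemma Pmax_pos: "Pmax > 0"
  unfolding Pmax_def using A by auto

lemma H_bounded:
  assumes "0 < h" "h \<le> R / 2"
  shows "eventually (\<lambda>e. 0 \<le> H (U e) (R - h) \<and> H (U e) (R - h) \<le> Hmax) (at_right 0)"
proof -
  have "eventually (\<lambda>e. net (U e) (R - h) < 1) (at_right 0)"
    using net_tendsto_0[OF assms] by (rule order_tendstoD) simp
  with eventually_eps_pos show ?thesis
  proof eventually_elim
    case (elim e)
    interpret s: nstar_solution N R A B p q gl gu g e "U e" "U' e" using solution_at elim by blast
    have P: "P (U e) (R - h) \<le> Pmax" using s.P_le[of "R - h"] assms by auto
    have "E (U e) (R - h) \<le> 1 + Pmax" using elim P unfolding net_def by linarith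
    then have "E (U e) (R - h) / q \<le> (1 + Pmax) / q" "P (U e) (R - h) / p \<le> Pmax / p"
      using P p q by (auto intro: divide_right_mono)
    moreover have "E (U e) (R - h) / q \<ge> 0" "P (U e) (R - h) / p \<ge> 0"
      using s.E_pos s.P_pos p q by (auto intro!: divide_nonneg_pos less_imp_le)
    ultimately show ?case unfolding H_def Hmax_def by linarith
  qed
qed

lemma weight_bounds:
  assumes "x \<in> {R / 2..R}"
  shows "((R / 2) ^ (N - 1))\<^sup>2 * gl \<le> (x ^ (N - 1))\<^sup>2 * g x"
    and "(x ^ (N - 1))\<^sup>2 * g x \<le> (R ^ (N - 1))\<^sup>2 * gu"
proof -
  have x: "0 \<le> x" "x \<le> R" "R / 2 \<le> x" "0 \<le> R / 2" using assms R by auto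
  have pw: "(R / 2) ^ (N - 1) \<le> x ^ (N - 1)" "x ^ (N - 1) \<le> R ^ (N - 1)"
    using x by (intro power_mono; simp)+
  have "((R / 2) ^ (N - 1))\<^sup>2 \<le> (x ^ (N - 1))\<^sup>2" "(x ^ (N - 1))\<^sup>2 \<le> (R ^ (N - 1))\<^sup>2"
    using pw x by (intro power_mono; simp)+
  then show "((R / 2) ^ (N - 1))\<^sup>2 * gl \<le> (x ^ (N - 1))\<^sup>2 * g x"
    and "(x ^ (N - 1))\<^sup>2 * g x \<le> (R ^ (N - 1))\<^sup>2 * gu"
    using glu[of x] x gl by (auto intro!: mult_mono)
qed

text \<open>The lower energy inequality on [R/2, R] bounds \<open>H\<close> at \<open>R\<close> by
  its bounded value at \<open>R / 2\<close> plus a multiple of \<open>e\<^sup>2 * W\<^sup>2\<close>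
  at \<open>R\<close>. The boundary condition makes the latter
  \<open>flux\<^sup>2 / e\<^sup>2\<close>.\<close>

lemma E_R_bound: "\<exists>C > 0. eventually (\<lambda>e. E (U e) R \<le> C / e\<^sup>2) (at_right 0)"
proof -
  define k where "k = ((R / 2) ^ (N - 1))\<^sup>2 * gl"
  have k: "k > 0" unfolding k_def using R gl by auto
  define C where "C = q * Hmax + q * flux\<^sup>2 / (2 * k)"
  have Hm: "Hmax > 0" unfolding Hmax_def using Pmax_pos p q by (auto intro: add_pos_pos)
  have C: "C > 0" unfolding C_def using Hm q k by (intro add_pos_nonneg) auto
  have "eventually (\<lambda>e. E (U e) R \<le> C / e\<^sup>2) (at_right 0)"
    using eventually_eps_pos eventually_eps_less[OF zero_less_one] H_bounded[of "R / 2", OF half_gt_zero[OF R] order.refl]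
  proof eventually_elim
    case (elim e)
    interpret s: nstar_solution N R A B p q gl gu g e "U e" "U' e" using solution_at elim by blast
    have "k * (H (U e) R - H (U e) (R / 2)) \<le> e\<^sup>2 / 2 * ((W (U' e) R)\<^sup>2 - (W (U' e) (R / 2))\<^sup>2)"
      using R weight_bounds by (intro s.energy(1)[where ?k2.0 = "(R ^ (N - 1))\<^sup>2 * gu"]) (auto simp: k_def)
    also have "\<dots> \<le> e\<^sup>2 / 2 * (W (U' e) R)\<^sup>2" by (intro mult_left_mono) auto
    also have "\<dots> = (e\<^sup>2 * W (U' e) R)\<^sup>2 / (2 * e\<^sup>2)" using elim(1) by (simp add: power2_eq_square)
    also have "\<dots> = flux\<^sup>2 / (2 * e\<^sup>2)" unfolding s.W_R ..
    finally have "H (U e) R - H (U e) (R / 2) \<le> flux\<^sup>2 / (2 * e\<^sup>2) / k"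
      using k by (subst pos_le_divide_eq) (simp_all add: mult.commute)
    moreover have "E (U e) R / q \<le> H (U e) R" unfolding H_def using s.P_pos[of R] p by simp
    moreover have "H (U e) (R / 2) \<le> Hmax" using elim(3) by simp
    ultimately have "E (U e) R / q \<le> Hmax + flux\<^sup>2 / (2 * e\<^sup>2) / k" by linarith
    \<comment> \<open>Since \<open>e < 1\<close>, the constant is absorbed into the term of order 1
      / e^2.\<close>
    also have "Hmax \<le> Hmax / e\<^sup>2" using elim(1,2) Hm by (simp add: pos_le_divide_eq power_le_one mult_left_le)
    finally have "E (U e) R / q \<le> Hmax / e\<^sup>2 + flux\<^sup>2 / (2 * e\<^sup>2) / k" by simp
    then have "E (U e) R \<le> q * (Hmax / e\<^sup>2 + flux\<^sup>2 / (2 * e\<^sup>2) / k)"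
      using q by (simp add: pos_divide_le_eq mult.commute)
    also have "\<dots> = C / e\<^sup>2" unfolding C_def by (simp add: distrib_left add_divide_distrib mult_ac)
    finally show ?case .
  qed
  with C show ?thesis by blast
qed

text \<open>Because \<open>coefB\<close> stays above \<open>A\<close>, the order 1 / e^2 bound on
  \<open>E\<close> passes to \<open>exp (- q * U e R)\<close>; its logarithm produces the factor
  \<open>2 / q\<close>.\<close>

lemma U_R_bound: "\<exists>C. eventually (\<lambda>e. - U e R \<le> 2 / q * ln (1 / e) + C) (at_right 0)"
proof -
  obtain C where C: "C > 0" "eventually (\<lambda>e. E (U e) R \<le> C / e\<^sup>2) (at_right 0)" using E_R_bound by blast
  have "eventually (\<lambda>e. - U e R \<le> 2 / q * ln (1 / e) + ln (C / A) / q) (at_right 0)"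
    using eventually_eps_pos C(2)
  proof eventually_elim
    case (elim e)
    interpret s: nstar_solution N R A B p q gl gu g e "U e" "U' e" using solution_at elim by blast
    have "A * exp (- q * U e R) \<le> C / e\<^sup>2"
      using elim(2) mult_right_mono[OF s.coefB_ge exp_ge_zero, of "- q * U e R"] unfolding E_def by linarith
    then have "exp (- q * U e R) \<le> C / A * (1 / e)\<^sup>2"
      using A elim(1) by (simp add: field_simps)
    then have "- q * U e R \<le> ln (C / A * (1 / e)\<^sup>2)"
      using C(1) A elim(1) by (metis exp_gt_zero ln_exp ln_le_cancel_iff order_less_le_trans)
    also have "\<dots> = ln (C / A) + 2 * ln (1 / e)"
      using C(1) A elim(1) by (subst ln_mult) (auto simp: ln_realpow)
    finally show ?case using q by (simp add: field_simps)
  qed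
  then show ?thesis by blast
qed

text \<open>At \<open>r = R - e powr \<kappa>\<close> the drop \<open>U e 0 - U e r\<close> is
  exponentially small by \<open>U_drop_le\<close> and \<open>net_decay\<close>. The main
  contribution in \<open>U0_bound\<close> is therefore the layer width times the logarithmic bound
  on \<open>- U e R\<close>.\<close>

lemma bulk_estimate:
  assumes \<kappa>: "0 < \<kappa>" "\<kappa> < 1"
  shows "\<exists>C>0. eventually (\<lambda>e. \<forall>r\<in>{0..R - e powr \<kappa>}. \<bar>U e r\<bar> \<le> C * e powr \<kappa> * ln (1 / e)) (at_right 0)"
proof -
  obtain C0 where C0: "eventually (\<lambda>e. - U e R \<le> 2 / q * ln (1 / e) + C0) (at_right 0)"
    using U_R_bound by blast
  define K where "K = 2 * flux / (R / 2) ^ (N - 1) / slope"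
  define c where "c = rate / 2"
  have c: "c > 0" unfolding c_def using rate_pos by auto
  \<comment> \<open>The summand 1 pays for the drop inside the bulk. In the other summand
    \<open>2 / q\<close> comes from \<open>U_R_bound\<close>, and the extra 1 absorbs
    \<open>umax + C0\<close> into the logarithm.\<close>
  define C where "C = 1 + real N / R * (2 / q + 1)"
  have C: "C > 0" unfolding C_def using R q by (intro add_pos_nonneg) auto
  have e1: "eventually (\<lambda>e. K / e powr \<kappa> * exp (- c * e powr \<kappa> / e) \<le> e powr \<kappa> * ln (1 / e)) (at_right 0)"
    using c \<kappa> by real_asymp
  have e2: "eventually (\<lambda>e. umax + C0 \<le> ln (1 / e)) (at_right 0)"
    by real_asymp
  have "((\<lambda>e. e powr \<kappa>) \<longlongrightarrow> 0) (at_right 0)" using \<kappa> by real_asymp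
  then have e3: "eventually (\<lambda>e. e powr \<kappa> < R / 2) (at_right 0)"
    by (rule order_tendstoD) (use R in simp)
  have "eventually (\<lambda>e. \<forall>r\<in>{0..R - e powr \<kappa>}. \<bar>U e r\<bar> \<le> C * e powr \<kappa> * ln (1 / e)) (at_right 0)"
    using eventually_eps_pos C0 e1 e2 e3
  proof eventually_elim
    case (elim e)
    interpret s: nstar_solution N R A B p q gl gu g e "U e" "U' e" using solution_at elim by blast
    define r where "r = R - e powr \<kappa>"
    have ek: "e powr \<kappa> > 0" using elim by auto
    have r: "0 \<le> r" "r \<le> R" "R / 2 \<le> r" "r < R" using ek elim R unfolding r_def by auto
    have "U e 0 - U e r \<le> net (U e) r / slope" using s.U_drop_le r by auto
    also have "\<dots> \<le> 2 * flux / ((R / 2) ^ (N - 1) * (R - r)) * exp (- rate * (R - r) / (2 * e)) / slope"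
      using s.net_decay[of r] r slope_pos by (intro divide_right_mono) auto
    also have "\<dots> = K / e powr \<kappa> * exp (- c * e powr \<kappa> / e)"
      unfolding K_def c_def r_def by simp
    also have "\<dots> \<le> e powr \<kappa> * ln (1 / e)" by (rule elim)
    finally have d: "U e 0 - U e r \<le> e powr \<kappa> * ln (1 / e)" .
    have "U e 0 - U e R \<le> (2 / q + 1) * ln (1 / e)"
      using elim(2,4) s.U0_le by (simp add: algebra_simps)
    then have "real N * e powr \<kappa> / R * (U e 0 - U e R) \<le> real N * e powr \<kappa> / R * ((2 / q + 1) * ln (1 / e))"
      using ek R by (intro mult_left_mono) auto
    moreover have "U e 0 \<le> (U e 0 - U e r) + real N * e powr \<kappa> / R * (U e 0 - U e R)"
      using s.U0_bound[of r] r by (simp add: r_def)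
    ultimately have "U e 0 \<le> e powr \<kappa> * ln (1 / e) + real N * e powr \<kappa> / R * ((2 / q + 1) * ln (1 / e))"
      using d by linarith
    also have "\<dots> = C * e powr \<kappa> * ln (1 / e)" unfolding C_def by (simp add: algebra_simps)
    finally have up: "U e 0 \<le> C * e powr \<kappa> * ln (1 / e)" .
    have "0 \<le> e powr \<kappa> * ln (1 / e)" using d s.U_le[of r] r by linarith
    then have "1 * (e powr \<kappa> * ln (1 / e)) \<le> C * (e powr \<kappa> * ln (1 / e))"
      unfolding C_def using R q by (intro mult_right_mono) auto
    then have d': "U e 0 - U e r \<le> C * e powr \<kappa> * ln (1 / e)" using d by (simp add: mult.assoc)
    show ?case
    proof
      fix x assume x: "x \<in> {0..R - e powr \<kappa>}"
      have x': "0 \<le> x" "x \<le> r" using x by (auto simp: r_def)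
      \<comment> \<open>By monotonicity \<open>U e x\<close> lies between \<open>U e r\<close> and
        \<open>U e 0\<close>; since \<open>U e 0\<close> is nonnegative, the bounds on
        \<open>U e 0\<close> and on the drop control the absolute value.\<close>
      then have "U e x \<le> U e 0" "U e r \<le> U e x"
        using s.U_le[of x] s.U_antimono[of x r] r by linarith+
      then show "\<bar>U e x\<bar> \<le> C * e powr \<kappa> * ln (1 / e)"
        using up d' s.U0_nonneg by linarith
    qed
  qed
  with C show ?thesis by blast
qed

lemma flux_estimate:
  assumes \<kappa>: "0 < \<kappa>" "\<kappa> < 1"
  shows "\<exists>M>0. eventually (\<lambda>e. \<forall>r\<in>{0..R - e powr \<kappa>}. r ^ (N - 1) * \<bar>U' e r\<bar> \<le> exp (- M / e powr (1 - \<kappa>))) (at_right 0)"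
proof -
  \<comment> \<open>Half of the decay rate is kept; the other half beats the prefactor
    \<open>flux / (e\<^sup>2 * gl)\<close>.\<close>
  define M where "M = rate / 2"
  have M: "M > 0" unfolding M_def using rate_pos by auto
  have e1: "eventually (\<lambda>e. flux * exp (- rate * e powr \<kappa> / e) / e\<^sup>2 / gl \<le> exp (- M / e powr (1 - \<kappa>))) (at_right 0)"
  proof -
    define K where "K = flux / gl"
    have "eventually (\<lambda>e. K / e\<^sup>2 * exp (- M / e powr (1 - \<kappa>)) \<le> 1) (at_right 0)"
      using M \<kappa> by real_asymp
    with eventually_eps_pos show ?thesis
    proof eventually_elim
      case (elim e)
      have "e powr \<kappa> / e = 1 / e powr (1 - \<kappa>)"
        using elim(1) by (simp add: powr_diff)
      then have "- rate * (e powr \<kappa> / e) = - M / e powr (1 - \<kappa>) + - M / e powr (1 - \<kappa>)"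
        unfolding M_def by simp
      then have "exp (- rate * e powr \<kappa> / e) = exp (- M / e powr (1 - \<kappa>)) * exp (- M / e powr (1 - \<kappa>))"
        by (metis exp_add times_divide_eq_right)
      then have "flux * exp (- rate * e powr \<kappa> / e) / e\<^sup>2 / gl
          = (K / e\<^sup>2 * exp (- M / e powr (1 - \<kappa>))) * exp (- M / e powr (1 - \<kappa>))"
        unfolding K_def by (simp add: mult_ac)
      also have "\<dots> \<le> 1 * exp (- M / e powr (1 - \<kappa>))"
        using elim(2) by (intro mult_right_mono) auto
      finally show ?case by simp
    qed
  qed
  have "eventually (\<lambda>e. \<forall>r\<in>{0..R - e powr \<kappa>}. r ^ (N - 1) * \<bar>U' e r\<bar> \<le> exp (- M / e powr (1 - \<kappa>))) (at_right 0)"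
    using eventually_eps_pos e1
  proof eventually_elim
    case (elim e)
    interpret s: nstar_solution N R A B p q gl gu g e "U e" "U' e" using solution_at elim by blast
    show ?case
    proof
      fix r assume r: "r \<in> {0..R - e powr \<kappa>}"
      have ek: "e powr \<kappa> > 0" using elim by auto
      have rk: "0 \<le> r" "r \<le> R - e powr \<kappa>" using r by auto
      then have rR: "0 \<le> r" "r \<le> R" "e powr \<kappa> \<le> R - r" using ek by linarith+
      have gr: "gl \<le> g r" using glu[of r] rR by auto
      have W0: "0 \<le> W (U' e) r" using s.W_nonneg rR by auto
      have "g r * (r ^ (N - 1) * \<bar>U' e r\<bar>) = \<bar>W (U' e) r\<bar>"
        unfolding W_def using rR gr gl by (simp add: abs_mult)
      then have eq: "g r * (r ^ (N - 1) * \<bar>U' e r\<bar>) = W (U' e) r" using W0 by simp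
      have "gl * (r ^ (N - 1) * \<bar>U' e r\<bar>) \<le> g r * (r ^ (N - 1) * \<bar>U' e r\<bar>)"
        using gr rR by (intro mult_right_mono) auto
      also note eq
      also have "W (U' e) r \<le> flux * exp (- rate * (R - r) / e) / e\<^sup>2"
        using s.W_decay[of r] rR elim(1) by (simp add: field_simps)
      also have "\<dots> \<le> flux * exp (- rate * e powr \<kappa> / e) / e\<^sup>2"
      proof -
        have "rate * e powr \<kappa> / e \<le> rate * (R - r) / e"
          using rate_pos rR elim(1) by (intro divide_right_mono mult_left_mono) auto
        then show ?thesis using flux_pos by (intro divide_right_mono mult_left_mono) auto
      qed
      finally have "r ^ (N - 1) * \<bar>U' e r\<bar> \<le> flux * exp (- rate * e powr \<kappa> / e) / e\<^sup>2 / gl"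
        using gl by (subst pos_le_divide_eq) (simp_all add: mult.commute)
      also have "\<dots> \<le> exp (- M / e powr (1 - \<kappa>))" by (rule elim)
      finally show "r ^ (N - 1) * \<bar>U' e r\<bar> \<le> exp (- M / e powr (1 - \<kappa>))" .
    qed
  qed
  with M show ?thesis by blast
qed

lemma U0_tendsto: "((\<lambda>e. U e 0) \<longlongrightarrow> 0) (at_right 0)"
proof -
  obtain C where C: "eventually (\<lambda>e. \<forall>r\<in>{0..R - e powr (1/2)}. \<bar>U e r\<bar> \<le> C * e powr (1/2) * ln (1 / e)) (at_right 0)"
    using bulk_estimate[of "1/2"] by auto
  have "((\<lambda>e. e powr (1/2)) \<longlongrightarrow> 0) (at_right (0::real))" by real_asymp
  then have e3: "eventually (\<lambda>e. e powr (1/2) < R) (at_right 0)"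
    by (rule order_tendstoD) (use R in simp)
  show ?thesis
  proof (rule Lim_null_comparison)
    show "eventually (\<lambda>e. norm (U e 0) \<le> C * e powr (1/2) * ln (1 / e)) (at_right 0)"
      using C e3 by eventually_elim auto
    show "((\<lambda>e. C * e powr (1/2) * ln (1 / e)) \<longlongrightarrow> 0) (at_right 0)" by real_asymp
  qed
qed

text \<open>The lower bound is \<open>coefB_ge\<close>. For the upper one, \<open>E\<close> at the
  origin is \<open>net + P\<close>, where \<open>net\<close> is dominated by its vanishing value at
  \<open>R / 2\<close> and \<open>P\<close> by \<open>A * exp (p * U e 0)\<close>; finally
  \<open>U e 0\<close> tends to 0.\<close>

lemma coefB_tendsto: "((\<lambda>e. coefB (U e)) \<longlongrightarrow> A) (at_right 0)"
proof (rule tendsto_sandwich)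
  show "eventually (\<lambda>e. A \<le> coefB (U e)) (at_right 0)"
    using eventually_eps_pos by eventually_elim (use nstar_solution.coefB_ge[OF solution_at] in auto)
  show "eventually (\<lambda>e. coefB (U e) \<le> exp (q * U e 0) * (net (U e) (R - R / 2) + A * exp (p * U e 0))) (at_right 0)"
    using eventually_eps_pos
  proof eventually_elim
    case (elim e)
    interpret s: nstar_solution N R A B p q gl gu g e "U e" "U' e" using solution_at elim by blast
    have "P (U e) 0 \<le> A * exp (p * U e 0)" unfolding P_def using s.coefA_le by auto
    moreover have "net (U e) 0 \<le> net (U e) (R - R / 2)" using s.net_mono[of 0 "R - R / 2"] R by auto
    ultimately have "E (U e) 0 \<le> net (U e) (R - R / 2) + A * exp (p * U e 0)" unfolding net_def by linarith
    then show ?case unfolding E_def by (simp add: exp_minus field_simps)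
  qed
  have "((\<lambda>e. exp (q * U e 0) * (net (U e) (R - R / 2) + A * exp (p * U e 0))) \<longlongrightarrow> exp (q * 0) * (0 + A * exp (p * 0))) (at_right 0)"
    using R by (intro tendsto_intros U0_tendsto net_tendsto_0) auto
  then show "((\<lambda>e. exp (q * U e 0) * (net (U e) (R - R / 2) + A * exp (p * U e 0))) \<longlongrightarrow> A) (at_right 0)" by simp
qed simp

section \<open>The first integral near the boundary\<close>

definition kR :: real where "kR = (R ^ (N - 1))\<^sup>2 * g R"

definition near :: "(real \<Rightarrow> real) \<Rightarrow> bool" where
  "near \<xi> \<longleftrightarrow> (\<forall>e>0. 0 < \<xi> e \<and> \<xi> e \<le> R) \<and> ((\<lambda>e. (R - \<xi> e) / e) \<longlongrightarrow> 0) (at_right 0)"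

lemma near_pos: "near \<xi> \<Longrightarrow> e > 0 \<Longrightarrow> 0 < \<xi> e" and near_le: "near \<xi> \<Longrightarrow> e > 0 \<Longrightarrow> \<xi> e \<le> R"
  unfolding near_def by auto

lemma near_tendsto:
  assumes "near \<xi>" shows "(\<xi> \<longlongrightarrow> R) (at_right 0)"
proof -
  have "((\<lambda>e. R - (R - \<xi> e) / e * e) \<longlongrightarrow> R - 0 * 0) (at_right 0)"
    using assms unfolding near_def by (intro tendsto_intros) auto
  moreover have "eventually (\<lambda>e. R - (R - \<xi> e) / e * e = \<xi> e) (at_right 0)"
    using eventually_eps_pos by eventually_elim auto
  ultimately show ?thesis
    using tendsto_cong by fastforce
qed

lemma near_half: "near \<xi> \<Longrightarrow> h > 0 \<Longrightarrow> eventually (\<lambda>e. R - h < \<xi> e) (at_right 0)"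
  using near_tendsto by (rule order_tendstoD) auto

text \<open>The upper energy inequality started at \<open>R / 2\<close> bounds
  \<open>(e * W)\<^sup>2\<close> by a multiple of \<open>H\<close> plus a bounded term, and
  \<open>E \<ge> A\<close> converts both into multiples of \<open>E\<close>. This crude bound
  precedes the exact limit in \<open>slope_ratio\<close>.\<close>

lemma W_le_sqrt_E:
  "\<exists>C>0. eventually (\<lambda>e. \<forall>r\<in>{R / 2..R}. e * W (U' e) r \<le> C * sqrt (E (U e) r)) (at_right 0)"
proof -
  define k where "k = (R ^ (N - 1))\<^sup>2 * gu"
  have k: "k > 0" unfolding k_def using R gu by auto
  \<comment> \<open>The first summand is the constant in the bound of \<open>2 * k * H\<close> by
    \<open>E\<close>; \<open>1 / A\<close> accounts for the energy at \<open>R / 2\<close>,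
    eventually at most 1.\<close>
  define D where "D = 2 * k * (1 / q + Pmax / (A * p)) + 1 / A"
  have D: "D > 0" unfolding D_def using k q Pmax_pos A p by (intro add_pos_pos mult_pos_pos divide_pos_pos) auto
  have hR: "0 < R / 2" "R / 2 \<le> R / 2" "R / 2 \<le> R" using R by auto
  have "eventually (\<lambda>e. e * W (U' e) (R - R / 2) < 1) (at_right 0)"
    using W_tendsto_0[OF hR(1,3)] by (rule order_tendstoD) simp
  with eventually_eps_pos H_bounded[OF hR(1,2)]
  have "eventually (\<lambda>e. \<forall>r\<in>{R / 2..R}. e * W (U' e) r \<le> sqrt D * sqrt (E (U e) r)) (at_right 0)"
  proof eventually_elim
    case (elim e)
    interpret s: nstar_solution N R A B p q gl gu g e "U e" "U' e" using solution_at elim by blast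
    show ?case
    proof
      fix r assume r: "r \<in> {R / 2..R}"
      have en: "e\<^sup>2 / 2 * ((W (U' e) r)\<^sup>2 - (W (U' e) (R / 2))\<^sup>2) \<le> k * (H (U e) r - H (U e) (R / 2))"
        using R r weight_bounds
        by (intro s.energy(2)[where ?k1.0 = "((R / 2) ^ (N - 1))\<^sup>2 * gl"]) (auto simp: k_def)
      have "0 \<le> H (U e) (R / 2)" using elim(2) by simp
      then have "k * (H (U e) r - H (U e) (R / 2)) \<le> k * H (U e) r" using k by simp
      with en have "e\<^sup>2 / 2 * ((W (U' e) r)\<^sup>2 - (W (U' e) (R / 2))\<^sup>2) \<le> k * H (U e) r" by linarith
      then have 1: "(e * W (U' e) r)\<^sup>2 \<le> 2 * (k * H (U e) r) + (e * W (U' e) (R / 2))\<^sup>2"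
        by (simp add: power_mult_distrib algebra_simps)
      have "0 \<le> e * W (U' e) (R / 2)" using s.W_nonneg[of "R / 2"] elim(1) R by auto
      then have 2: "(e * W (U' e) (R / 2))\<^sup>2 \<le> 1" using elim(3) by (simp add: power_le_one)
      have EA: "1 \<le> E (U e) r / A" using s.E_ge[of r] r R A by (simp add: pos_le_divide_eq)
      have "P (U e) r / p \<le> Pmax / p * 1" using s.P_le[of r] r R p by (simp add: divide_right_mono)
      also have "\<dots> \<le> Pmax / p * (E (U e) r / A)" using EA Pmax_pos p by (intro mult_left_mono) auto
      finally have "H (U e) r \<le> (1 / q + Pmax / (A * p)) * E (U e) r"
        unfolding H_def by (simp add: algebra_simps)
      then have "k * H (U e) r \<le> k * ((1 / q + Pmax / (A * p)) * E (U e) r)" using k by simp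
      with 1 2 EA have "(e * W (U' e) r)\<^sup>2 \<le> 2 * (k * ((1 / q + Pmax / (A * p)) * E (U e) r)) + E (U e) r / A"
        by linarith
      also have "\<dots> = D * E (U e) r" unfolding D_def by (simp add: distrib_right)
      finally have "e * W (U' e) r \<le> sqrt (D * E (U e) r)" by (rule real_le_rsqrt)
      then show "e * W (U' e) r \<le> sqrt D * sqrt (E (U e) r)" by (simp add: real_sqrt_mult)
    qed
  qed
  then show ?thesis using D by (intro exI[of _ "sqrt D"]) auto
qed

text \<open>By \<open>W_le_sqrt_E\<close> the quotient in \<open>sigma_mvt\<close> is O(1/e), so
  over a distance o(e) the quantity 1 / sqrt E changes by o(1). Its value at \<open>R\<close> is
  itself O(e).\<close>

lemma sigma_tendsto_0:
  assumes \<xi>: "near \<xi>"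
  shows "((\<lambda>e. 1 / sqrt (E (U e) (\<xi> e))) \<longlongrightarrow> 0) (at_right 0)"
proof -
  obtain C where C: "C > 0"
    and evC: "eventually (\<lambda>e. \<forall>r\<in>{R / 2..R}. e * W (U' e) r \<le> C * sqrt (E (U e) r)) (at_right 0)"
    using W_le_sqrt_E by blast
  define D where "D = C / ((R / 2) ^ (N - 1) * gl)"
  show ?thesis
  proof (rule tendsto_sandwich)
    show "eventually (\<lambda>e. 0 \<le> 1 / sqrt (E (U e) (\<xi> e))) (at_right 0)"
      using eventually_eps_pos by eventually_elim (use nstar_solution.E_pos[OF solution_at] in \<open>auto intro: less_imp_le\<close>)
    show "eventually (\<lambda>e. 1 / sqrt (E (U e) (\<xi> e)) \<le> C / flux * e + (R - \<xi> e) / e * (q / 2 * D)) (at_right 0)"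
      using eventually_eps_pos evC near_half[OF \<xi> half_gt_zero[OF R]]
    proof eventually_elim
      case (elim e)
      interpret s: nstar_solution N R A B p q gl gu g e "U e" "U' e" using solution_at elim by blast
      have xi: "0 < \<xi> e" "\<xi> e \<le> R" "R / 2 \<le> \<xi> e" using near_pos[OF \<xi> elim(1)] near_le[OF \<xi> elim(1)] elim(3) by auto
      obtain z where z: "\<xi> e \<le> z" "z \<le> R"
        and eq: "1 / sqrt (E (U e) (\<xi> e)) - 1 / sqrt (E (U e) R) = (R - \<xi> e) * (q / 2) * (- U' e z / sqrt (E (U e) z))"
        using s.sigma_mvt[OF xi(1,2)] by blast
      have sq: "\<And>r. sqrt (E (U e) r) > 0" using s.E_pos by simp
      have zR: "0 < z" "z \<in> {R / 2..R}" using z xi by auto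
      have "(R / 2) ^ (N - 1) * gl \<le> z ^ (N - 1) * g z"
        using zR R glu[of z] gl by (intro mult_mono power_mono) auto
      moreover have "(R / 2) ^ (N - 1) * gl > 0" using R gl by auto
      ultimately have "- U' e z \<le> W (U' e) z / ((R / 2) ^ (N - 1) * gl)"
        unfolding s.U'_eq[OF zR(1) z(2)] using s.W_nonneg[of z] zR by (intro divide_left_mono) auto
      also have "W (U' e) z \<le> C * sqrt (E (U e) z) / e"
        using elim(2) zR elim(1) by (simp add: pos_le_divide_eq mult.commute)
      also have "C * sqrt (E (U e) z) / e / ((R / 2) ^ (N - 1) * gl) = D / e * sqrt (E (U e) z)"
        unfolding D_def by simp
      finally have "- U' e z \<le> D / e * sqrt (E (U e) z)"
        using \<open>(R / 2) ^ (N - 1) * gl > 0\<close> by (simp add: divide_right_mono)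
      then have "- U' e z / sqrt (E (U e) z) \<le> D / e" using sq[of z] by (subst pos_divide_le_eq)
      then have "(R - \<xi> e) * (q / 2) * (- U' e z / sqrt (E (U e) z)) \<le> (R - \<xi> e) * (q / 2) * (D / e)"
        using xi q by (intro mult_left_mono) auto
      also have "\<dots> = (R - \<xi> e) / e * (q / 2 * D)" by simp
      finally have a: "1 / sqrt (E (U e) (\<xi> e)) \<le> 1 / sqrt (E (U e) R) + (R - \<xi> e) / e * (q / 2 * D)"
        using eq by linarith
      \<comment> \<open>The prescribed boundary flux forces sqrt E at \<open>R\<close> to be at
        least of order 1 / e.\<close>
      have "e * W (U' e) R = flux / e"
        using s.W_R elim(1) by (simp add: field_simps power2_eq_square)
      then have "flux / e \<le> C * sqrt (E (U e) R)" using elim(2) R by force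
      then have "1 / sqrt (E (U e) R) \<le> C / flux * e"
        using sq[of R] flux_pos elim(1) by (simp add: field_simps)
      with a show ?case by linarith
    qed
    have "((\<lambda>e. C / flux * e + (R - \<xi> e) / e * (q / 2 * D)) \<longlongrightarrow> C / flux * 0 + 0 * (q / 2 * D)) (at_right 0)"
      using \<xi> unfolding near_def by (intro tendsto_intros) auto
    then show "((\<lambda>e. C / flux * e + (R - \<xi> e) / e * (q / 2 * D)) \<longlongrightarrow> 0) (at_right 0)" by simp
  qed simp
qed

lemma inv_E_tendsto_0:
  assumes \<xi>: "near \<xi>"
  shows "((\<lambda>e. 1 / E (U e) (\<xi> e)) \<longlongrightarrow> 0) (at_right 0)"
proof -
  have "((\<lambda>e. (1 / sqrt (E (U e) (\<xi> e)))\<^sup>2) \<longlongrightarrow> 0\<^sup>2) (at_right 0)"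
    by (intro tendsto_intros sigma_tendsto_0[OF \<xi>])
  moreover have "eventually (\<lambda>e. (1 / sqrt (E (U e) (\<xi> e)))\<^sup>2 = 1 / E (U e) (\<xi> e)) (at_right 0)"
    using eventually_eps_pos
    by eventually_elim (use nstar_solution.E_pos[OF solution_at] in \<open>simp add: power_divide less_imp_le\<close>)
  ultimately show ?thesis using tendsto_cong by fastforce
qed

lemma kR_cont: "((\<lambda>x. (x ^ (N - 1))\<^sup>2 * g x) \<longlongrightarrow> kR) (at R within {0..R})"
  unfolding kR_def using g_cont R
  by (intro tendsto_intros) (auto simp: continuous_on_def)

lemma kR_pos: "kR > 0"
  unfolding kR_def using R g_pos[of R] by auto

text \<open>On [R - h, R] the weight is within \<open>d\<close> of \<open>kR\<close>, and the energy
  inequalities apply from \<open>R - h\<close> to \<open>\<xi> e\<close>. The terms at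
  \<open>R - h\<close> and the part \<open>P / p\<close> of \<open>H\<close> stay bounded, so
  division by the diverging \<open>E\<close> removes them and leaves \<open>kR / q\<close> up to an
  error of order \<open>d\<close>.\<close>

lemma energy_ratio:
  assumes \<xi>: "near \<xi>"
  shows "((\<lambda>e. (e * W (U' e) (\<xi> e))\<^sup>2 / 2 / E (U e) (\<xi> e)) \<longlongrightarrow> kR / q) (at_right 0)"
proof -
  let ?T = "\<lambda>e. (e * W (U' e) (\<xi> e))\<^sup>2 / 2 / E (U e) (\<xi> e)"
  have inv: "((\<lambda>e. 1 / E (U e) (\<xi> e)) \<longlongrightarrow> 0) (at_right 0)" by (rule inv_E_tendsto_0[OF \<xi>])
  have key: "eventually (\<lambda>e. ?T e < (kR + d) / q + y) (at_right 0) \<and>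
             eventually (\<lambda>e. (kR - d) / q - y < ?T e) (at_right 0)" if d: "0 < d" "d < kR" and y: "y > 0" for d y
  proof -
    have "eventually (\<lambda>x. dist ((x ^ (N - 1))\<^sup>2 * g x) kR < d) (at R within {0..R})"
      using kR_cont d(1) by (rule tendstoD)
    then obtain h0 where h0: "h0 > 0" "\<And>x. x \<in> {0..R} \<Longrightarrow> x \<noteq> R \<Longrightarrow> dist x R < h0 \<Longrightarrow> dist ((x ^ (N - 1))\<^sup>2 * g x) kR < d"
      unfolding eventually_at by auto
    define h where "h = min (h0 / 2) (R / 2)"
    have h: "0 < h" "h \<le> R / 2" "h < h0" "h \<le> R" unfolding h_def using h0 R by auto
    have w: "kR - d \<le> (x ^ (N - 1))\<^sup>2 * g x \<and> (x ^ (N - 1))\<^sup>2 * g x \<le> kR + d" if "x \<in> {R - h..R}" for x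
    proof (cases "x = R")
      case True then show ?thesis using d by (simp add: kR_def)
    next
      case False
      then have "dist ((x ^ (N - 1))\<^sup>2 * g x) kR < d" using that h R by (intro h0(2)) (auto simp: dist_real_def)
      then show ?thesis by (simp add: dist_real_def) linarith
    qed
    \<comment> \<open>\<open>a\<close> and \<open>b\<close> are the upper and lower energy bounds
      divided by \<open>E\<close>, written in terms of \<open>1 / E\<close> so that their limits can
      be read off.\<close>
    define a where "a e = (kR + d) * (1 / q + Pmax / p * (1 / E (U e) (\<xi> e))) + (e * W (U' e) (R - h))\<^sup>2 / 2 * (1 / E (U e) (\<xi> e))" for e
    define b where "b e = (kR - d) * (1 / q - Hmax * (1 / E (U e) (\<xi> e)))" for e
    have bounds: "eventually (\<lambda>e. ?T e \<le> a e \<and> b e \<le> ?T e) (at_right 0)"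
      using eventually_eps_pos near_half[OF \<xi> h(1)] H_bounded[OF h(1,2)]
    proof eventually_elim
      case (elim e)
      interpret s: nstar_solution N R A B p q gl gu g e "U e" "U' e" using solution_at elim by blast
      define x where "x = \<xi> e"
      have x: "0 < R - h" "R - h \<le> x" "x \<le> R" using near_le[OF \<xi> elim(1)] elim(2) h R by (auto simp: x_def)
      have Ex: "E (U e) x > 0" by (rule s.E_pos)
      have en: "(kR - d) * (H (U e) x - H (U e) (R - h)) \<le> e\<^sup>2 / 2 * ((W (U' e) x)\<^sup>2 - (W (U' e) (R - h))\<^sup>2)"
         "e\<^sup>2 / 2 * ((W (U' e) x)\<^sup>2 - (W (U' e) (R - h))\<^sup>2) \<le> (kR + d) * (H (U e) x - H (U e) (R - h))"
        using s.energy[OF x, of "kR - d" "kR + d"] w x by auto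
      have eqs: "e\<^sup>2 / 2 * ((W (U' e) x)\<^sup>2 - (W (U' e) (R - h))\<^sup>2) = (e * W (U' e) x)\<^sup>2 / 2 - (e * W (U' e) (R - h))\<^sup>2 / 2"
        by (simp add: power_mult_distrib algebra_simps)
      have Px: "0 \<le> P (U e) x / p" "P (U e) x / p \<le> Pmax / p"
        using s.P_pos[of x] s.P_le[of x] x p by (auto intro: divide_right_mono)
      have Hx: "H (U e) x \<le> E (U e) x / q + Pmax / p" "E (U e) x / q \<le> H (U e) x"
        unfolding H_def using Px by auto
      have Hh: "0 \<le> H (U e) (R - h)" "H (U e) (R - h) \<le> Hmax" using elim(3) by auto
      have "(kR + d) * (H (U e) x - H (U e) (R - h)) \<le> (kR + d) * (E (U e) x / q + Pmax / p)"
        using Hx Hh d kR_pos by (intro mult_left_mono) auto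
      then have "(e * W (U' e) x)\<^sup>2 / 2 \<le> (kR + d) * (E (U e) x / q + Pmax / p) + (e * W (U' e) (R - h))\<^sup>2 / 2"
        using en(2) unfolding eqs by linarith
      then have "(e * W (U' e) x)\<^sup>2 / 2 / E (U e) x
          \<le> ((kR + d) * (E (U e) x / q + Pmax / p) + (e * W (U' e) (R - h))\<^sup>2 / 2) / E (U e) x"
        using Ex by (intro divide_right_mono) auto
      also have "\<dots> = a e" unfolding a_def x_def[symmetric] using Ex by (simp add: add_divide_distrib distrib_left)
      finally have 1: "?T e \<le> a e" by (simp add: x_def)
      have "(kR - d) * (E (U e) x / q - Hmax) \<le> (kR - d) * (H (U e) x - H (U e) (R - h))"
        using Hx Hh d by (intro mult_left_mono) auto
      then have "(kR - d) * (E (U e) x / q - Hmax) \<le> (e * W (U' e) x)\<^sup>2 / 2"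
        using en(1) zero_le_power2[of "e * W (U' e) (R - h)"] unfolding eqs by linarith
      then have "(kR - d) * (E (U e) x / q - Hmax) / E (U e) x \<le> (e * W (U' e) x)\<^sup>2 / 2 / E (U e) x"
        using Ex by (intro divide_right_mono) auto
      moreover have "(kR - d) * (E (U e) x / q - Hmax) / E (U e) x = b e"
        unfolding b_def x_def[symmetric] using Ex by (simp add: diff_divide_distrib right_diff_distrib)
      ultimately show ?case using 1 by (simp add: x_def)
    qed
    have "(a \<longlongrightarrow> (kR + d) * (1 / q + Pmax / p * 0) + 0\<^sup>2 / 2 * 0) (at_right 0)"
      unfolding a_def by (intro tendsto_intros inv W_tendsto_0 h) auto
    then have up: "eventually (\<lambda>e. a e < (kR + d) / q + y) (at_right 0)"
      by (rule order_tendstoD) (use y in simp)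
    have "(b \<longlongrightarrow> (kR - d) * (1 / q - Hmax * 0)) (at_right 0)"
      unfolding b_def by (intro tendsto_intros inv)
    then have lo: "eventually (\<lambda>e. (kR - d) / q - y < b e) (at_right 0)"
      by (rule order_tendstoD) (use y in simp)
    show ?thesis
    proof
      show "eventually (\<lambda>e. ?T e < (kR + d) / q + y) (at_right 0)"
        using up bounds by eventually_elim linarith
      show "eventually (\<lambda>e. (kR - d) / q - y < ?T e) (at_right 0)"
        using lo bounds by eventually_elim linarith
    qed
  qed
  show ?thesis
  proof (rule tendstoI)
    fix y :: real assume y: "y > 0"
    \<comment> \<open>Half of the tolerance \<open>y\<close> covers the weight error
      \<open>d / q\<close>; the other half covers convergence at fixed \<open>d\<close>.\<close>
    define d where "d = min (kR / 2) (q * y / 2)"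
    have d: "0 < d" "d < kR" "d \<le> q * y / 2" unfolding d_def using kR_pos q y by auto
    have "d / q \<le> y / 2" using d(3) q by (simp add: pos_divide_le_eq mult.commute)
    then have b: "(kR + d) / q + y / 2 \<le> kR / q + y" "kR / q - y \<le> (kR - d) / q - y / 2"
      unfolding add_divide_distrib diff_divide_distrib by linarith+
    note k = key[OF d(1,2) half_gt_zero[OF y]]
    show "eventually (\<lambda>e. dist (?T e) (kR / q) < y) (at_right 0)"
      using k[THEN conjunct1] k[THEN conjunct2]
    proof eventually_elim
      case (elim e)
      then show ?case using b by (simp only: dist_real_def abs_less_iff) linarith
    qed
  qed
qed

definition cR :: real where "cR = sqrt (2 / (q * g R))"

lemma cR_pos: "cR > 0"
  unfolding cR_def using q g_pos[of R] R by auto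

text \<open>Since \<open>W\<close> is \<open>- U'\<close> times r^(N-1) g, dividing
  \<open>energy_ratio\<close> by the squared weight and taking roots isolates - e U' / sqrt
  E.\<close>

lemma slope_ratio:
  assumes \<xi>: "near \<xi>"
  shows "((\<lambda>e. e * - U' e (\<xi> e) / sqrt (E (U e) (\<xi> e))) \<longlongrightarrow> cR) (at_right 0)"
proof -
  have gR: "g R > 0" using g_pos[of R] R by auto
  let ?d = "\<lambda>e. (\<xi> e ^ (N - 1) * g (\<xi> e))\<^sup>2"

  have gc: "((\<lambda>e. g (\<xi> e)) \<longlongrightarrow> g R) (at_right 0)"
  proof (rule continuous_on_tendsto_compose[OF g_cont near_tendsto[OF \<xi>]])
    show "eventually (\<lambda>e. \<xi> e \<in> {0..R}) (at_right 0)"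
      using eventually_eps_pos by eventually_elim (use near_pos[OF \<xi>] near_le[OF \<xi>] in \<open>auto intro: less_imp_le\<close>)
  qed (use R in auto)
  have "((\<lambda>e. sqrt ((e * W (U' e) (\<xi> e))\<^sup>2 / 2 / E (U e) (\<xi> e) * 2 / ?d e))
      \<longlongrightarrow> sqrt (kR / q * 2 / (R ^ (N - 1) * g R)\<^sup>2)) (at_right 0)"
    using gR R by (intro tendsto_intros energy_ratio[OF \<xi>] gc near_tendsto[OF \<xi>]) auto
  moreover have "kR / q * 2 / (R ^ (N - 1) * g R)\<^sup>2 = 2 / (q * g R)"
    unfolding kR_def using gR R q by (simp add: power2_eq_square)
  moreover have "eventually (\<lambda>e. sqrt ((e * W (U' e) (\<xi> e))\<^sup>2 / 2 / E (U e) (\<xi> e) * 2 / ?d e)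
     = e * - U' e (\<xi> e) / sqrt (E (U e) (\<xi> e))) (at_right 0)"
    using eventually_eps_pos
  proof eventually_elim
    case (elim e)
    interpret s: nstar_solution N R A B p q gl gu g e "U e" "U' e" using solution_at elim by blast
    define x where "x = \<xi> e"
    have x: "0 < x" "x \<le> R" using near_pos[OF \<xi> elim] near_le[OF \<xi> elim] by (auto simp: x_def)
    have D: "x \<noteq> 0" "g x \<noteq> 0" using x g_pos[of x] by auto
    have "W (U' e) x = - U' e x * (x ^ (N - 1) * g x)" unfolding W_def by simp
    then have "(e * W (U' e) x)\<^sup>2 / 2 / E (U e) x * 2 / (x ^ (N - 1) * g x)\<^sup>2 = (e * - U' e x)\<^sup>2 / E (U e) x"
      using D by (simp add: power_mult_distrib)
    \<comment> \<open>The sign of \<open>U'\<close> selects the correct square root.\<close>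
    moreover have "0 \<le> e * - U' e x" using s.U'_nonpos[OF x] elim by (simp add: mult_nonneg_nonpos)
    ultimately have "sqrt ((e * W (U' e) x)\<^sup>2 / 2 / E (U e) x * 2 / (x ^ (N - 1) * g x)\<^sup>2) = e * - U' e x / sqrt (E (U e) x)"
      by (simp add: real_sqrt_divide)
    then show ?case by (simp add: x_def)
  qed
  ultimately show ?thesis
    unfolding cR_def using tendsto_cong by fastforce
qed

section \<open>Boundary layer asymptotics\<close>

text \<open>\<open>cR * (lead \<beta> \<gamma> / 2)\<close> is the limit of the rescaled 1 / sqrt E.
  The first term is the growth across the distance to \<open>R\<close>, the second the value at
  \<open>R\<close>; \<open>chi1\<close> and \<open>chi2\<close> keep whichever dominates.\<close>

definition lead :: "real \<Rightarrow> real \<Rightarrow> real" where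
  "lead \<beta> \<gamma> = \<gamma> * q * chi1 \<beta> + 2 * real N * g R / (R * (B - A)) * chi2 \<beta>"

text \<open>Allowing \<open>\<xi> e = R\<close> with \<open>\<gamma> = 0\<close> lets the same
  asymptotics describe the boundary value.\<close>

definition approach :: "real \<Rightarrow> real \<Rightarrow> (real \<Rightarrow> real) \<Rightarrow> bool" where
  "approach \<beta> \<gamma> \<xi> \<longleftrightarrow> (\<forall>e>0. 0 < \<xi> e \<and> \<xi> e \<le> R) \<and>
     ((\<lambda>e. (R - \<xi> e) / e powr \<beta>) \<longlongrightarrow> \<gamma>) (at_right 0)"

lemma approach_near:
  assumes "\<beta> > 1" "approach \<beta> \<gamma> \<xi>"
  shows "near \<xi>"
proof -
  have "((\<lambda>e. e powr (\<beta> - 1)) \<longlongrightarrow> 0) (at_right 0)" using assms(1) by real_asymp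
  then have "((\<lambda>e. (R - \<xi> e) / e powr \<beta> * e powr (\<beta> - 1)) \<longlongrightarrow> \<gamma> * 0) (at_right 0)"
    using assms(2) unfolding approach_def by (intro tendsto_intros) auto
  moreover have "eventually (\<lambda>e. (R - \<xi> e) / e powr \<beta> * e powr (\<beta> - 1) = (R - \<xi> e) / e) (at_right 0)"
    using eventually_eps_pos by eventually_elim (simp add: powr_diff)
  ultimately have "((\<lambda>e. (R - \<xi> e) / e) \<longlongrightarrow> 0) (at_right 0)"
    using tendsto_cong by fastforce
  then show ?thesis using assms(2) unfolding near_def approach_def by auto
qed

lemma near_R: "near (\<lambda>e. R)"
  unfolding near_def using R by auto

text \<open>In 1 / sqrt E the distance contributes at order \<beta> - 1 and the boundary value at
  order 1. After division by the dominant order \<open>min 1 (\<beta> - 1)\<close>,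
  \<open>chi1\<close> is the limiting factor of the former and \<open>chi2\<close> that of the
  latter.\<close>

lemma powr_chi1: "\<beta> > 1 \<Longrightarrow> ((\<lambda>e. e powr (\<beta> - 1 - min 1 (\<beta> - 1))) \<longlongrightarrow> chi1 \<beta>) (at_right (0::real))"
proof (cases "\<beta> \<le> 2")
  case True
  have "eventually (\<lambda>e. e powr (\<beta> - 1 - min 1 (\<beta> - 1)) = (1::real)) (at_right 0)"
    using eventually_eps_pos by eventually_elim (use True in \<open>simp add: min_def\<close>)
  then show ?thesis using True by (auto simp: chi1_def intro: tendsto_eventually)
next
  case False
  then have "((\<lambda>e::real. e powr (\<beta> - 2)) \<longlongrightarrow> 0) (at_right 0)" by real_asymp
  then show ?thesis using False by (simp add: chi1_def min_def)
qed

lemma powr_chi2: "\<beta> > 1 \<Longrightarrow> ((\<lambda>e. e powr (1 - min 1 (\<beta> - 1))) \<longlongrightarrow> chi2 \<beta>) (at_right (0::real))"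
proof (cases "\<beta> \<ge> 2")
  case True
  have "eventually (\<lambda>e. e powr (1 - min 1 (\<beta> - 1)) = (1::real)) (at_right 0)"
    using eventually_eps_pos by eventually_elim (use True in \<open>simp add: min_def\<close>)
  then show ?thesis using True by (auto simp: chi2_def intro: tendsto_eventually)
next
  case False
  then have "((\<lambda>e::real. e powr (2 - \<beta>)) \<longlongrightarrow> 0) (at_right 0)" by real_asymp
  then show ?thesis using False by (simp add: chi2_def min_def)
qed

text \<open>The boundary condition gives \<open>U' e R\<close> explicitly, so
  \<open>slope_ratio\<close> at the point \<open>R\<close> can be solved for 1 / sqrt E.\<close>

lemma sigma_R: "((\<lambda>e. 1 / sqrt (E (U e) R) / e) \<longlongrightarrow> cR * (real N * g R / (R * (B - A)))) (at_right 0)"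
proof -
  have gR: "g R > 0" using g_pos[of R] R by auto
  have "((\<lambda>e. e * - U' e R / sqrt (E (U e) R) * (real N * g R / (R * (B - A))))
      \<longlongrightarrow> cR * (real N * g R / (R * (B - A)))) (at_right 0)"
    by (intro tendsto_intros slope_ratio[OF near_R])
  moreover have "eventually (\<lambda>e. e * - U' e R / sqrt (E (U e) R) * (real N * g R / (R * (B - A)))
      = 1 / sqrt (E (U e) R) / e) (at_right 0)"
    using eventually_eps_pos
  proof eventually_elim
    case (elim e)
    have "U' e R = R * (A - B) / (e\<^sup>2 * real N * g R)"
      using sols[OF elim] unfolding solves_Nstar_def by blast
    then have "- U' e R = R * (B - A) / (e\<^sup>2 * real N * g R)"
      by (metis minus_diff_eq minus_divide_left mult_minus_right)
    then have "e * - U' e R * (real N * g R / (R * (B - A))) = 1 / e"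
      using gR R AB elim N_facts(3) by (simp add: power2_eq_square)
    then show ?case unfolding times_divide_eq_left by simp
  qed
  ultimately show ?thesis using tendsto_cong by fastforce
qed

text \<open>The mean value formula splits 1 / sqrt E at \<open>\<xi> e\<close> into its value at
  \<open>R\<close> and a multiple of the distance. The intermediate point \<open>\<zeta> e\<close>
  lies between \<open>\<xi> e\<close> and \<open>R\<close>, hence is also \<open>near\<close>, so
  \<open>slope_ratio\<close> supplies the limit of the multiplier.\<close>

lemma sigma_asym:
  assumes \<beta>: "\<beta> > 1" and \<xi>: "approach \<beta> \<gamma> \<xi>"
  shows "((\<lambda>e. 1 / sqrt (E (U e) (\<xi> e)) / e powr min 1 (\<beta> - 1)) \<longlongrightarrow> cR * (lead \<beta> \<gamma> / 2)) (at_right 0)"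
proof -
  let ?m = "min 1 (\<beta> - 1)"
  have n\<xi>: "near \<xi>" by (rule approach_near[OF \<beta> \<xi>])
  have "\<forall>e. \<exists>z. e > 0 \<longrightarrow> \<xi> e \<le> z \<and> z \<le> R \<and>
      1 / sqrt (E (U e) (\<xi> e)) - 1 / sqrt (E (U e) R) = (R - \<xi> e) * (q / 2) * (- U' e z / sqrt (E (U e) z))"
    using nstar_solution.sigma_mvt[OF solution_at] near_pos[OF n\<xi>] near_le[OF n\<xi>] by meson
  then obtain \<zeta> where \<zeta>: "\<And>e. e > 0 \<Longrightarrow> \<xi> e \<le> \<zeta> e" "\<And>e. e > 0 \<Longrightarrow> \<zeta> e \<le> R"
    "\<And>e. e > 0 \<Longrightarrow> 1 / sqrt (E (U e) (\<xi> e)) - 1 / sqrt (E (U e) R)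
      = (R - \<xi> e) * (q / 2) * (- U' e (\<zeta> e) / sqrt (E (U e) (\<zeta> e)))"
    by metis
  have n\<zeta>: "near \<zeta>"
    unfolding near_def
  proof (intro conjI allI impI)
    show "0 < \<zeta> e" "\<zeta> e \<le> R" if "e > 0" for e
      using near_pos[OF n\<xi> that] \<zeta>(1,2)[OF that] by linarith+
    show "((\<lambda>e. (R - \<zeta> e) / e) \<longlongrightarrow> 0) (at_right 0)"
    proof (rule tendsto_sandwich)
      show "eventually (\<lambda>e. 0 \<le> (R - \<zeta> e) / e) (at_right 0)"
        using eventually_eps_pos by eventually_elim (use \<zeta>(2) in auto)
      show "eventually (\<lambda>e. (R - \<zeta> e) / e \<le> (R - \<xi> e) / e) (at_right 0)"
        using eventually_eps_pos by eventually_elim (use \<zeta>(1) in \<open>auto intro: divide_right_mono\<close>)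
      show "((\<lambda>e. (R - \<xi> e) / e) \<longlongrightarrow> 0) (at_right 0)" using n\<xi> unfolding near_def by blast
    qed simp
  qed
  have "((\<lambda>e. 1 / sqrt (E (U e) R) / e * e powr (1 - ?m)
      + (R - \<xi> e) / e powr \<beta> * e powr (\<beta> - 1 - ?m) * (q / 2) * (e * - U' e (\<zeta> e) / sqrt (E (U e) (\<zeta> e))))
      \<longlongrightarrow> cR * (real N * g R / (R * (B - A))) * chi2 \<beta> + \<gamma> * chi1 \<beta> * (q / 2) * cR) (at_right 0)"
    using \<xi> unfolding approach_def
    by (intro tendsto_intros sigma_R powr_chi1[OF \<beta>] powr_chi2[OF \<beta>] slope_ratio[OF n\<zeta>]) auto
  also have "cR * (real N * g R / (R * (B - A))) * chi2 \<beta> + \<gamma> * chi1 \<beta> * (q / 2) * cR = cR * (lead \<beta> \<gamma> / 2)"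
  proof -
    define K where "K = real N * g R / (R * (B - A))"
    have "2 * real N * g R / (R * (B - A)) = 2 * K" by (simp add: K_def)
    then show ?thesis unfolding lead_def K_def[symmetric] by (simp add: algebra_simps)
  qed
  finally have lim: "((\<lambda>e. 1 / sqrt (E (U e) R) / e * e powr (1 - ?m)
      + (R - \<xi> e) / e powr \<beta> * e powr (\<beta> - 1 - ?m) * (q / 2) * (e * - U' e (\<zeta> e) / sqrt (E (U e) (\<zeta> e))))
      \<longlongrightarrow> cR * (lead \<beta> \<gamma> / 2)) (at_right 0)" .
  have "eventually (\<lambda>e. 1 / sqrt (E (U e) R) / e * e powr (1 - ?m)
      + (R - \<xi> e) / e powr \<beta> * e powr (\<beta> - 1 - ?m) * (q / 2) * (e * - U' e (\<zeta> e) / sqrt (E (U e) (\<zeta> e)))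
      = 1 / sqrt (E (U e) (\<xi> e)) / e powr ?m) (at_right 0)"
    using eventually_eps_pos
  proof eventually_elim
    case (elim e)
    have 1: "e powr (1 - ?m) / e = 1 / e powr ?m"
      using elim by (simp add: powr_diff)
    have 2: "e powr (\<beta> - 1 - ?m) * e / e powr \<beta> = 1 / e powr ?m"
      using elim by (simp add: powr_diff)
    let ?y = "- U' e (\<zeta> e) / sqrt (E (U e) (\<zeta> e))"
    have "1 / sqrt (E (U e) R) / e * e powr (1 - ?m) + (R - \<xi> e) / e powr \<beta> * e powr (\<beta> - 1 - ?m) * (q / 2) * (e * - U' e (\<zeta> e) / sqrt (E (U e) (\<zeta> e)))
      = 1 / sqrt (E (U e) R) * (e powr (1 - ?m) / e) + ((R - \<xi> e) * (q / 2) * ?y) * (e powr (\<beta> - 1 - ?m) * e / e powr \<beta>)"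
      by (simp add: mult_ac)
    also have "\<dots> = (1 / sqrt (E (U e) R) + (R - \<xi> e) * (q / 2) * ?y) * (1 / e powr ?m)"
      unfolding 1 2 by (rule distrib_right[symmetric])
    also have "1 / sqrt (E (U e) R) + (R - \<xi> e) * (q / 2) * ?y = 1 / sqrt (E (U e) (\<xi> e))"
      using \<zeta>(3)[OF elim] by linarith
    finally show ?case by simp
  qed
  then show ?thesis using lim tendsto_cong by fastforce
qed

text \<open>When \<open>\<gamma> = 0\<close> positivity must come from the boundary term, which is
  present for \<open>\<beta> \<ge> 2\<close>.\<close>

lemma lead_pos:
  assumes "\<beta> > 1" "\<gamma> \<ge> 0" "\<gamma> > 0 \<or> \<beta> \<ge> 2"
  shows "lead \<beta> \<gamma> > 0"
proof -
  have gR: "g R > 0" using g_pos[of R] R by auto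
  have "2 * real N * g R / (R * (B - A)) > 0" using gR N_facts(3) R AB by simp
  then show ?thesis
    unfolding lead_def chi1_def chi2_def using assms q
    by (auto intro: add_nonneg_pos add_pos_nonneg mult_nonneg_nonneg)
qed

lemma cR_lead_pos: "\<beta> > 1 \<Longrightarrow> \<gamma> \<ge> 0 \<Longrightarrow> \<gamma> > 0 \<or> \<beta> \<ge> 2 \<Longrightarrow> cR * (lead \<beta> \<gamma> / 2) > 0"
  using lead_pos[of \<beta> \<gamma>] cR_pos by simp

text \<open>Taking logarithms in \<open>E = coefB * exp (- q * U)\<close> expresses \<open>U\<close>
  through \<open>coefB\<close>, which tends to \<open>A\<close>, and 1 / sqrt E, whose asymptotics
  are \<open>sigma_asym\<close>.\<close>

lemma U_asym:
  assumes \<beta>: "\<beta> > 1" and \<xi>: "approach \<beta> \<gamma> \<xi>" and \<gamma>: "\<gamma> \<ge> 0" "\<gamma> > 0 \<or> \<beta> \<ge> 2"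
  shows "((\<lambda>e. U e (\<xi> e) - (- (2 / q) * min 1 (\<beta> - 1) * ln (1 / e)
      + (2 / q) * ln (sqrt (A / (2 * q * g R)) * lead \<beta> \<gamma>))) \<longlongrightarrow> 0) (at_right 0)"
proof -
  let ?m = "min 1 (\<beta> - 1)" and ?s = "\<lambda>e. 1 / sqrt (E (U e) (\<xi> e)) / e powr min 1 (\<beta> - 1)"
  let ?K = "ln (sqrt (A / (2 * q * g R)) * lead \<beta> \<gamma>)"
  have gR: "g R > 0" using g_pos[of R] R by auto
  have pos: "cR * (lead \<beta> \<gamma> / 2) > 0" by (rule cR_lead_pos[OF \<beta> \<gamma>])
  have "((\<lambda>e. (ln (coefB (U e)) + 2 * ln (?s e)) / q - 2 / q * ?K)
      \<longlongrightarrow> (ln A + 2 * ln (cR * (lead \<beta> \<gamma> / 2))) / q - 2 / q * ?K) (at_right 0)"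
    using A pos q by (intro tendsto_intros coefB_tendsto sigma_asym[OF \<beta> \<xi>]) auto
  moreover have "(ln A + 2 * ln (cR * (lead \<beta> \<gamma> / 2))) / q - 2 / q * ?K = 0"
  proof -
    \<comment> \<open>This merges the limits of the coefficient and of the slope quotient into the
      constant under the logarithm.\<close>
    have sq: "sqrt A * cR / 2 = sqrt (A / (2 * q * g R))"
    proof -
      have "sqrt A * cR / 2 = sqrt A * cR / sqrt 4" by simp
      also have "\<dots> = sqrt (A * (2 / (q * g R)) / 4)"
        unfolding cR_def by (simp only: real_sqrt_mult real_sqrt_divide)
      also have "A * (2 / (q * g R)) / 4 = A / (2 * q * g R)" by (simp add: field_simps)
      finally show ?thesis .
    qed
    have "?K = ln (sqrt A * (cR * (lead \<beta> \<gamma> / 2)))"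
      unfolding sq[symmetric] by (simp add: mult_ac)
    also have "\<dots> = ln A / 2 + ln (cR * (lead \<beta> \<gamma> / 2))"
      using A pos by (subst ln_mult) (auto simp: ln_sqrt)
    finally show ?thesis using q by (simp add: field_simps)
  qed
  moreover have "eventually (\<lambda>e. (ln (coefB (U e)) + 2 * ln (?s e)) / q - 2 / q * ?K
      = U e (\<xi> e) - (- (2 / q) * ?m * ln (1 / e) + (2 / q) * ?K)) (at_right 0)"
    using eventually_eps_pos
  proof eventually_elim
    case (elim e)
    interpret s: nstar_solution N R A B p q gl gu g e "U e" "U' e" using solution_at elim by blast
    have E: "E (U e) (\<xi> e) > 0" by (rule s.E_pos)
    have "ln (E (U e) (\<xi> e)) = ln (coefB (U e)) - q * U e (\<xi> e)"
      unfolding E_def using s.coefB_pos by (simp add: ln_mult)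
    moreover have "ln (?s e) = - (ln (E (U e) (\<xi> e)) / 2) - ?m * ln e"
      using E elim by (simp add: ln_div ln_mult ln_powr ln_sqrt)
    ultimately have "ln (coefB (U e)) + 2 * ln (?s e) = q * U e (\<xi> e) - 2 * (?m * ln e)" by linarith
    then have "(ln (coefB (U e)) + 2 * ln (?s e)) / q = U e (\<xi> e) + 2 / q * ?m * ln (1 / e)"
      using q elim by (simp add: diff_divide_distrib ln_div)
    then show ?case by (simp add: algebra_simps)
  qed
  ultimately show ?thesis by (rule tendsto_eq_eventually)
qed

text \<open>Dividing \<open>slope_ratio\<close> by \<open>sigma_asym\<close> eliminates sqrt E;
  \<open>cR\<close> cancels and only \<open>lead\<close> remains.\<close>

lemma U'_asym:
  assumes \<beta>: "\<beta> > 1" and \<xi>: "approach \<beta> \<gamma> \<xi>" and \<gamma>: "\<gamma> \<ge> 0" "\<gamma> > 0 \<or> \<beta> \<ge> 2"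
  shows "((\<lambda>e. U' e (\<xi> e) / (- (2 / lead \<beta> \<gamma>) * e powr (- 1 - min 1 (\<beta> - 1)))) \<longlongrightarrow> 1) (at_right 0)"
proof -
  let ?m = "min 1 (\<beta> - 1)" and ?s = "\<lambda>e. 1 / sqrt (E (U e) (\<xi> e)) / e powr min 1 (\<beta> - 1)"
  have L: "lead \<beta> \<gamma> > 0" by (rule lead_pos[OF \<beta> \<gamma>])
  have pos: "cR * (lead \<beta> \<gamma> / 2) > 0" by (rule cR_lead_pos[OF \<beta> \<gamma>])
  have "((\<lambda>e. (e * - U' e (\<xi> e) / sqrt (E (U e) (\<xi> e))) / ?s e * (lead \<beta> \<gamma> / 2))
     \<longlongrightarrow> cR / (cR * (lead \<beta> \<gamma> / 2)) * (lead \<beta> \<gamma> / 2)) (at_right 0)"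
    using pos by (intro tendsto_intros slope_ratio approach_near[OF \<beta> \<xi>] sigma_asym[OF \<beta> \<xi>]) auto
  moreover have "cR / (cR * (lead \<beta> \<gamma> / 2)) * (lead \<beta> \<gamma> / 2) = 1" using cR_pos L by simp
  moreover have "eventually (\<lambda>e. (e * - U' e (\<xi> e) / sqrt (E (U e) (\<xi> e))) / ?s e * (lead \<beta> \<gamma> / 2)
     = U' e (\<xi> e) / (- (2 / lead \<beta> \<gamma>) * e powr (- 1 - ?m))) (at_right 0)"
    using eventually_eps_pos
  proof eventually_elim
    case (elim e)
    have "sqrt (E (U e) (\<xi> e)) > 0" using nstar_solution.E_pos[OF solution_at[OF elim]] by simp
    then have "(e * - U' e (\<xi> e) / sqrt (E (U e) (\<xi> e))) / ?s e * (lead \<beta> \<gamma> / 2) = - U' e (\<xi> e) * (e * e powr ?m) * (lead \<beta> \<gamma> / 2)"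
      by simp
    moreover have "e powr (- 1 - ?m) = 1 / (e * e powr ?m)"
      using elim by (simp add: powr_diff powr_minus divide_simps)
    ultimately show ?case using L elim by simp
  qed
  ultimately show ?thesis by (rule tendsto_eq_eventually)
qed

text \<open>In \<open>rho = E - P\<close> the term \<open>P\<close> is at most \<open>Pmax\<close>
  while \<open>E\<close> diverges, so the squared inverse of \<open>sigma_asym\<close> decides the
  limit.\<close>

lemma rho_asym:
  assumes \<beta>: "\<beta> > 1" and \<xi>: "approach \<beta> \<gamma> \<xi>" and \<gamma>: "\<gamma> \<ge> 0" "\<gamma> > 0 \<or> \<beta> \<ge> 2"
  shows "((\<lambda>e. rho N R A B p q (U e) (\<xi> e) / (2 * q * g R / (lead \<beta> \<gamma>)\<^sup>2 * e powr (- 2 * min 1 (\<beta> - 1)))) \<longlongrightarrow> 1) (at_right 0)"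
proof -
  let ?m = "min 1 (\<beta> - 1)" and ?s = "\<lambda>e. 1 / sqrt (E (U e) (\<xi> e)) / e powr min 1 (\<beta> - 1)"
  let ?c = "2 * q * g R / (lead \<beta> \<gamma>)\<^sup>2"
  have gR: "g R > 0" using g_pos[of R] R by auto
  have L: "lead \<beta> \<gamma> > 0" by (rule lead_pos[OF \<beta> \<gamma>])
  have pos: "cR * (lead \<beta> \<gamma> / 2) > 0" by (rule cR_lead_pos[OF \<beta> \<gamma>])
  have c: "(cR * (lead \<beta> \<gamma> / 2))\<^sup>2 = 1 / ?c"
    unfolding cR_def using q gR L by (simp add: power_mult_distrib power_divide)
  have n\<xi>: "near \<xi>" by (rule approach_near[OF \<beta> \<xi>])
  have PE: "((\<lambda>e. P (U e) (\<xi> e) / E (U e) (\<xi> e)) \<longlongrightarrow> 0) (at_right 0)"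
  proof (rule tendsto_sandwich)
    show "eventually (\<lambda>e. 0 \<le> P (U e) (\<xi> e) / E (U e) (\<xi> e)) (at_right 0)"
      using eventually_eps_pos by eventually_elim (use nstar_solution.E_pos[OF solution_at] nstar_solution.P_pos[OF solution_at] in \<open>auto intro!: divide_nonneg_pos less_imp_le\<close>)
    show "eventually (\<lambda>e. P (U e) (\<xi> e) / E (U e) (\<xi> e) \<le> Pmax * (1 / E (U e) (\<xi> e))) (at_right 0)"
      using eventually_eps_pos
    proof eventually_elim
      case (elim e)
      have "P (U e) (\<xi> e) \<le> Pmax"
        using nstar_solution.P_le[OF solution_at[OF elim], of "\<xi> e"] near_pos[OF n\<xi> elim] near_le[OF n\<xi> elim] by simp
      then have "P (U e) (\<xi> e) / E (U e) (\<xi> e) \<le> Pmax / E (U e) (\<xi> e)"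
        using nstar_solution.E_pos[OF solution_at[OF elim]] by (intro divide_right_mono) (auto intro: less_imp_le)
      then show ?case by simp
    qed
    have "((\<lambda>e. Pmax * (1 / E (U e) (\<xi> e))) \<longlongrightarrow> Pmax * 0) (at_right 0)"
      by (intro tendsto_intros inv_E_tendsto_0[OF n\<xi>])
    then show "((\<lambda>e. Pmax * (1 / E (U e) (\<xi> e))) \<longlongrightarrow> 0) (at_right 0)" by simp
  qed simp
  have "((\<lambda>e. (1 - P (U e) (\<xi> e) / E (U e) (\<xi> e)) / (?s e)\<^sup>2 / ?c) \<longlongrightarrow> (1 - 0) / (cR * (lead \<beta> \<gamma> / 2))\<^sup>2 / ?c) (at_right 0)"
    using pos gR q L by (intro tendsto_intros PE sigma_asym[OF \<beta> \<xi>]) auto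
  moreover have "(1 - 0) / (cR * (lead \<beta> \<gamma> / 2))\<^sup>2 / ?c = 1"
    unfolding c using gR q L by simp
  moreover have "eventually (\<lambda>e. (1 - P (U e) (\<xi> e) / E (U e) (\<xi> e)) / (?s e)\<^sup>2 / ?c
    = rho N R A B p q (U e) (\<xi> e) / (?c * e powr (- 2 * ?m))) (at_right 0)"
    using eventually_eps_pos
  proof eventually_elim
    case (elim e)
    interpret s: nstar_solution N R A B p q gl gu g e "U e" "U' e" using solution_at elim by blast
    have E: "E (U e) (\<xi> e) > 0" by (rule s.E_pos)
    have rho: "rho N R A B p q (U e) (\<xi> e) = E (U e) (\<xi> e) - P (U e) (\<xi> e)"
      unfolding rho_def s.nstar_rhs_eq net_def by simp
    have "e powr (- 2 * ?m) = 1 / (e powr ?m)\<^sup>2"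
      using elim by (simp add: powr_minus powr_powr flip: powr_realpow inverse_eq_divide) (simp add: mult.commute)
    moreover have "(?s e)\<^sup>2 = 1 / E (U e) (\<xi> e) / (e powr ?m)\<^sup>2"
      using E by (simp add: power_divide power_mult_distrib)
    moreover have "(1 - P (U e) (\<xi> e) / E (U e) (\<xi> e)) = (E (U e) (\<xi> e) - P (U e) (\<xi> e)) / E (U e) (\<xi> e)"
      using E by (simp add: diff_divide_distrib)
    ultimately show ?case unfolding rho using E by simp
  qed
  ultimately show ?thesis by (rule tendsto_eq_eventually)
qed

lemma bulk_flux_estimate:
  assumes "0 < \<kappa>" "\<kappa> < 1"
  shows "\<exists>C M. C > 0 \<and> M > 0 \<and>
          (\<forall>\<^sub>F e in at_right 0.
             (\<forall>r\<in>{0..R - e powr \<kappa>}. \<bar>U e r\<bar> \<le> C * e powr \<kappa> * ln (1 / e)) \<and>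
             (\<forall>r\<in>{0..R - e powr \<kappa>}. r ^ (N - 1) * \<bar>U' e r\<bar> \<le> exp (- M / e powr (1 - \<kappa>))))"
proof -
  obtain C where "C > 0" "eventually (\<lambda>e. \<forall>r\<in>{0..R - e powr \<kappa>}. \<bar>U e r\<bar> \<le> C * e powr \<kappa> * ln (1 / e)) (at_right 0)"
    using bulk_estimate[OF assms] by blast
  moreover obtain M where "M > 0"
    "eventually (\<lambda>e. \<forall>r\<in>{0..R - e powr \<kappa>}. r ^ (N - 1) * \<bar>U' e r\<bar> \<le> exp (- M / e powr (1 - \<kappa>))) (at_right 0)"
    using flux_estimate[OF assms] by blast
  ultimately show ?thesis using eventually_conj by blast
qed

text \<open>For \<open>\<beta> > 2\<close> the factor \<open>chi1\<close> vanishes and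
  \<open>lead\<close> does not depend on \<open>\<gamma>\<close>. Hence the expansions at
  \<open>\<xi> e\<close> and at \<open>R\<close>, the latter with \<open>\<gamma> = 0\<close>,
  coincide.\<close>

lemma U_asym_diff:
  assumes \<beta>: "\<beta> > 2" and \<gamma>: "\<gamma> > 0" and \<xi>: "approach \<beta> \<gamma> \<xi>"
  shows "((\<lambda>e. U e (\<xi> e) - U e R) \<longlongrightarrow> 0) (at_right 0)"
    and "((\<lambda>e. U' e (\<xi> e) / U' e R) \<longlongrightarrow> 1) (at_right 0)"
proof -
  have R0: "approach \<beta> 0 (\<lambda>e. R)" unfolding approach_def using R by auto
  have L: "lead \<beta> 0 = lead \<beta> \<gamma>" unfolding lead_def chi1_def using \<beta> by simp
  have \<beta>1: "\<beta> > 1" using \<beta> by simp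
  have \<gamma>': "\<gamma> \<ge> 0" "\<gamma> > 0 \<or> \<beta> \<ge> 2" using \<gamma> by auto
  have z: "(0::real) \<ge> 0" "(0::real) > 0 \<or> \<beta> \<ge> 2" using \<beta> by auto
  show "((\<lambda>e. U e (\<xi> e) - U e R) \<longlongrightarrow> 0) (at_right 0)"
    using tendsto_diff[OF U_asym[OF \<beta>1 \<xi> \<gamma>'] U_asym[OF \<beta>1 R0 z]] unfolding L by simp
  let ?c = "\<lambda>e. - (2 / lead \<beta> \<gamma>) * e powr (- 1 - min 1 (\<beta> - 1))"
  have "((\<lambda>e. (U' e (\<xi> e) / ?c e) / (U' e R / ?c e)) \<longlongrightarrow> 1 / 1) (at_right 0)"
    using U'_asym[OF \<beta>1 \<xi> \<gamma>'] U'_asym[OF \<beta>1 R0 z] unfolding L by (intro tendsto_divide) auto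
  moreover have "eventually (\<lambda>e. (U' e (\<xi> e) / ?c e) / (U' e R / ?c e) = U' e (\<xi> e) / U' e R) (at_right 0)"
    using eventually_eps_pos
  proof eventually_elim
    case (elim e)
    have "?c e \<noteq> 0" using elim lead_pos[OF \<beta>1 \<gamma>'] by simp
    then show ?case by (metis divide_divide_times_eq mult.commute mult_divide_mult_cancel_left)
  qed
  ultimately show "((\<lambda>e. U' e (\<xi> e) / U' e R) \<longlongrightarrow> 1) (at_right 0)"
    using tendsto_cong by fastforce
qed

end

section \<open>Assembly of the two orderings of A and B\<close>

theorem theorem5p1:
  fixes N :: nat and R A B p q :: real and g :: "real \<Rightarrow> real"
    and U U' :: "real \<Rightarrow> real \<Rightarrow> real"
  assumes N: "N \<ge> 2" and R: "R > 0"
    and gpos: "\<forall>r\<in>{0..R}. g r > 0" and gsmooth: "smooth_on {0..R} g"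
    and A: "A > 0" and B: "B > 0" and p: "p > 0" and q: "q > 0" and AB: "A \<noteq> B"
    and sol: "\<forall>\<epsilon>>0. solves_Nstar N R g A B p q \<epsilon> (U \<epsilon>) (U' \<epsilon>)"
  shows
    "(\<forall>\<epsilon>>0. (A < B \<longrightarrow> antimono_on {0..R} (U \<epsilon>)) \<and> (B < A \<longrightarrow> mono_on {0..R} (U \<epsilon>)))
   \<and> (\<forall>\<kappa>. 0 < \<kappa> \<and> \<kappa> < 1 \<longrightarrow>
        (\<exists>C M. C > 0 \<and> M > 0 \<and>
          (\<forall>\<^sub>F \<epsilon> in at_right 0.
             (\<forall>r\<in>{0..R - \<epsilon> powr \<kappa>}. \<bar>U \<epsilon> r\<bar> \<le> C * \<epsilon> powr \<kappa> * ln (1 / \<epsilon>)) \<and>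
             (\<forall>r\<in>{0..R - \<epsilon> powr \<kappa>}. r ^ (N - 1) * \<bar>U' \<epsilon> r\<bar> \<le> exp (- M / \<epsilon> powr (1 - \<kappa>))))))
   \<and> (\<forall>\<beta> \<gamma> (rr :: real \<Rightarrow> real).
        \<beta> > 1 \<and> \<gamma> > 0 \<and> (\<forall>\<epsilon>>0. rr \<epsilon> \<in> {0<..<R}) \<and>
        ((\<lambda>\<epsilon>. (R - rr \<epsilon>) / \<epsilon> powr \<beta>) \<longlongrightarrow> \<gamma>) (at_right 0) \<longrightarrow>
        (A < B \<longrightarrow>
           ((\<lambda>\<epsilon>. U \<epsilon> (rr \<epsilon>)
              - (- (2 / q) * min 1 (\<beta> - 1) * ln (1 / \<epsilon>)
                 + (2 / q) * ln (sqrt (A / (2 * q * g R))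
                      * (\<gamma> * q * chi1 \<beta> + 2 * real N * g R / (R * (B - A)) * chi2 \<beta>))))
             \<longlongrightarrow> 0) (at_right 0))
      \<and> (B < A \<longrightarrow>
           ((\<lambda>\<epsilon>. U \<epsilon> (rr \<epsilon>)
              - ((2 / p) * min 1 (\<beta> - 1) * ln (1 / \<epsilon>)
                 - (2 / p) * ln (sqrt (B / (2 * p * g R))
                      * (\<gamma> * p * chi1 \<beta> + 2 * real N * g R / (R * (A - B)) * chi2 \<beta>))))
             \<longlongrightarrow> 0) (at_right 0))
      \<and> (A < B \<longrightarrow>
           (\<beta> < 2 \<longrightarrow>
              ((\<lambda>\<epsilon>. U' \<epsilon> (rr \<epsilon>) / (- (2 / (\<gamma> * q)) * \<epsilon> powr (- \<beta>))) \<longlongrightarrow> 1) (at_right 0) \<and>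
              ((\<lambda>\<epsilon>. rho N R A B p q (U \<epsilon>) (rr \<epsilon>)
                   / (2 * g R / (\<gamma>\<^sup>2 * q) * \<epsilon> powr (- 2 * (\<beta> - 1)))) \<longlongrightarrow> 1) (at_right 0))
         \<and> (\<beta> = 2 \<longrightarrow>
              ((\<lambda>\<epsilon>. U' \<epsilon> (rr \<epsilon>)
                   / (- (2 / (\<gamma> * q + 2 * real N * g R / (R * (B - A)))) * \<epsilon> powr (- 2))) \<longlongrightarrow> 1) (at_right 0) \<and>
              ((\<lambda>\<epsilon>. rho N R A B p q (U \<epsilon>) (rr \<epsilon>)
                   / (2 * q * g R / (\<gamma> * q + 2 * real N * g R / (R * (B - A)))\<^sup>2 * \<epsilon> powr (- 2))) \<longlongrightarrow> 1) (at_right 0))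
         \<and> (\<beta> > 2 \<longrightarrow>
              ((\<lambda>\<epsilon>. U' \<epsilon> (rr \<epsilon>) / (- (R * (B - A) / (real N * g R)) * \<epsilon> powr (- 2))) \<longlongrightarrow> 1) (at_right 0) \<and>
              ((\<lambda>\<epsilon>. rho N R A B p q (U \<epsilon>) (rr \<epsilon>)
                   / (q * R\<^sup>2 * (B - A)\<^sup>2 / (2 * (real N)\<^sup>2 * g R) * \<epsilon> powr (- 2))) \<longlongrightarrow> 1) (at_right 0) \<and>
              ((\<lambda>\<epsilon>. U \<epsilon> (rr \<epsilon>) - U \<epsilon> R) \<longlongrightarrow> 0) (at_right 0) \<and>
              ((\<lambda>\<epsilon>. U' \<epsilon> (rr \<epsilon>) / U' \<epsilon> R) \<longlongrightarrow> 1) (at_right 0))))"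
proof -
  have gc: "continuous_on {0..R} g" by (rule smooth_on_continuous_on[OF gsmooth])
  \<comment> \<open>The extrema of \<open>g\<close> on the compact interval serve as the bounds
    \<open>gl\<close> and \<open>gu\<close>.\<close>
  obtain x where x: "x \<in> {0..R}" "\<And>y. y \<in> {0..R} \<Longrightarrow> g x \<le> g y"
    using continuous_attains_inf[OF _ _ gc] R by auto
  obtain z where z: "z \<in> {0..R}" "\<And>y. y \<in> {0..R} \<Longrightarrow> g y \<le> g z"
    using continuous_attains_sup[OF _ _ gc] R by auto
  have gx: "g x > 0" using gpos x(1) by blast
  have gR: "g R > 0" using gpos R by auto
  consider (lt) "A < B" | (gt) "B < A" using AB by linarith
  then show ?thesis
  proof cases
    case lt
    interpret f: nstar_family N R A B p q "g x" "g z" g U U'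
      by unfold_locales (use N R gsmooth gx x z A p q lt sol in auto)
    let ?h = "\<lambda>\<beta> \<gamma> rr. \<beta> > 1 \<and> \<gamma> > 0 \<and> (\<forall>\<epsilon>>0. rr \<epsilon> \<in> {0<..<R}) \<and>
        ((\<lambda>\<epsilon>. (R - rr \<epsilon>) / \<epsilon> powr \<beta>) \<longlongrightarrow> \<gamma>) (at_right 0)"
    have ap: "f.approach \<beta> \<gamma> rr" if "?h \<beta> \<gamma> rr" for \<beta> \<gamma> rr
      using that unfolding f.approach_def by (auto intro: less_imp_le)
    have L1: "f.lead \<beta> \<gamma> = \<gamma> * q" if "\<beta> < 2" for \<beta> \<gamma>
      using that unfolding f.lead_def chi1_def chi2_def by simp
    have L2: "f.lead 2 \<gamma> = \<gamma> * q + 2 * real N * g R / (R * (B - A))" for \<gamma>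
      unfolding f.lead_def chi1_def chi2_def by simp
    have L3: "f.lead \<beta> \<gamma> = 2 * real N * g R / (R * (B - A))" if "\<beta> > 2" for \<beta> \<gamma>
      using that unfolding f.lead_def chi1_def chi2_def by simp
    show ?thesis
    proof (intro conjI allI impI)
      show "antimono_on {0..R} (U e)" if "e > 0" for e
        using nstar_solution.U_antimono[OF f.solution_at[OF that]] by (auto intro!: monotone_onI)
      show "\<exists>C M. C > 0 \<and> M > 0 \<and>
          (\<forall>\<^sub>F \<epsilon> in at_right 0.
             (\<forall>r\<in>{0..R - \<epsilon> powr \<kappa>}. \<bar>U \<epsilon> r\<bar> \<le> C * \<epsilon> powr \<kappa> * ln (1 / \<epsilon>)) \<and>
             (\<forall>r\<in>{0..R - \<epsilon> powr \<kappa>}. r ^ (N - 1) * \<bar>U' \<epsilon> r\<bar> \<le> exp (- M / \<epsilon> powr (1 - \<kappa>))))"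
        if "0 < \<kappa> \<and> \<kappa> < 1" for \<kappa>
        using f.bulk_flux_estimate that by blast
      fix \<beta> \<gamma> and rr :: "real \<Rightarrow> real"
      assume h: "?h \<beta> \<gamma> rr"
      have \<beta>: "\<beta> > 1" and \<gamma>: "\<gamma> \<ge> 0" "\<gamma> > 0 \<or> \<beta> \<ge> 2" using h by auto
      note U'_lim = f.U'_asym[OF \<beta> ap[OF h] \<gamma>] and rho_lim = f.rho_asym[OF \<beta> ap[OF h] \<gamma>]
      show "((\<lambda>\<epsilon>. U \<epsilon> (rr \<epsilon>)
              - (- (2 / q) * min 1 (\<beta> - 1) * ln (1 / \<epsilon>)
                 + (2 / q) * ln (sqrt (A / (2 * q * g R))
                      * (\<gamma> * q * chi1 \<beta> + 2 * real N * g R / (R * (B - A)) * chi2 \<beta>))))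
             \<longlongrightarrow> 0) (at_right 0)"
        using f.U_asym[OF \<beta> ap[OF h] \<gamma>] unfolding f.lead_def .
      show "((\<lambda>\<epsilon>. U' \<epsilon> (rr \<epsilon>) / (- (2 / (\<gamma> * q)) * \<epsilon> powr (- \<beta>))) \<longlongrightarrow> 1) (at_right 0)"
        if "\<beta> < 2"
        using U'_lim that unfolding L1[OF that] by (simp add: min_def)
      show "((\<lambda>\<epsilon>. rho N R A B p q (U \<epsilon>) (rr \<epsilon>)
                   / (2 * g R / (\<gamma>\<^sup>2 * q) * \<epsilon> powr (- 2 * (\<beta> - 1)))) \<longlongrightarrow> 1) (at_right 0)"
        if "\<beta> < 2"
      proof -
        have "2 * q * g R / (\<gamma> * q)\<^sup>2 = 2 * g R / (\<gamma>\<^sup>2 * q)"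
          using q by (simp add: power2_eq_square)
        moreover have "min 1 (\<beta> - 1) = \<beta> - 1" using that by simp
        ultimately show ?thesis using rho_lim unfolding L1[OF that] by simp
      qed
      show "((\<lambda>\<epsilon>. U' \<epsilon> (rr \<epsilon>)
                   / (- (2 / (\<gamma> * q + 2 * real N * g R / (R * (B - A)))) * \<epsilon> powr (- 2))) \<longlongrightarrow> 1) (at_right 0)"
        if "\<beta> = 2"
        using U'_lim unfolding that L2 by simp
      show "((\<lambda>\<epsilon>. rho N R A B p q (U \<epsilon>) (rr \<epsilon>)
                   / (2 * q * g R / (\<gamma> * q + 2 * real N * g R / (R * (B - A)))\<^sup>2 * \<epsilon> powr (- 2))) \<longlongrightarrow> 1) (at_right 0)"
        if "\<beta> = 2"
        using rho_lim unfolding that L2 by simp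
      show "((\<lambda>\<epsilon>. U' \<epsilon> (rr \<epsilon>) / (- (R * (B - A) / (real N * g R)) * \<epsilon> powr (- 2))) \<longlongrightarrow> 1) (at_right 0)"
        if "\<beta> > 2"
      proof -
        have "2 / (2 * real N * g R / (R * (B - A))) = R * (B - A) / (real N * g R)" by simp
        moreover have "- 1 - min 1 (\<beta> - 1) = - 2" using that by simp
        ultimately show ?thesis using U'_lim unfolding L3[OF that] by metis
      qed
      show "((\<lambda>\<epsilon>. rho N R A B p q (U \<epsilon>) (rr \<epsilon>)
                   / (q * R\<^sup>2 * (B - A)\<^sup>2 / (2 * (real N)\<^sup>2 * g R) * \<epsilon> powr (- 2))) \<longlongrightarrow> 1) (at_right 0)"
        if "\<beta> > 2"
      proof -
        have "2 * q * g R / (2 * real N * g R / (R * (B - A)))\<^sup>2 = q * R\<^sup>2 * (B - A)\<^sup>2 / (2 * (real N)\<^sup>2 * g R)"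
          using gR by (simp add: power_divide power_mult_distrib) (simp add: power2_eq_square)
        moreover have "- 2 * min 1 (\<beta> - 1) = - 2" using that by simp
        ultimately show ?thesis using rho_lim unfolding L3[OF that] by metis
      qed
      show "((\<lambda>\<epsilon>. U \<epsilon> (rr \<epsilon>) - U \<epsilon> R) \<longlongrightarrow> 0) (at_right 0)"
        and "((\<lambda>\<epsilon>. U' \<epsilon> (rr \<epsilon>) / U' \<epsilon> R) \<longlongrightarrow> 1) (at_right 0)"
        if "\<beta> > 2"
        using f.U_asym_diff[OF that _ ap[OF h]] h by blast+
    \<comment> \<open>The remaining goals assume \<open>B < A\<close> and are vacuous here.\<close>
    qed (use lt in \<open>blast dest: less_asym\<close>)+
  next
    case gt
    \<comment> \<open>The reflected family satisfies the hypotheses with the roles of the two ions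
      exchanged; \<open>tendsto_minus\<close> below returns to \<open>U\<close>.\<close>
    interpret f: nstar_family N R B A q p "g x" "g z" g "\<lambda>e r. - U e r" "\<lambda>e r. - U' e r"
      by unfold_locales (use N R gsmooth gx x z B p q gt sol solves_Nstar_minus in auto)
    let ?h = "\<lambda>\<beta> \<gamma> rr. \<beta> > 1 \<and> \<gamma> > 0 \<and> (\<forall>\<epsilon>>0. rr \<epsilon> \<in> {0<..<R}) \<and>
        ((\<lambda>\<epsilon>. (R - rr \<epsilon>) / \<epsilon> powr \<beta>) \<longlongrightarrow> \<gamma>) (at_right 0)"
    show ?thesis
    proof (intro conjI allI impI)
      show "mono_on {0..R} (U e)" if "e > 0" for e
        using nstar_solution.U_antimono[OF f.solution_at[OF that]] by (auto intro!: monotone_onI)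
      show "\<exists>C M. C > 0 \<and> M > 0 \<and>
          (\<forall>\<^sub>F \<epsilon> in at_right 0.
             (\<forall>r\<in>{0..R - \<epsilon> powr \<kappa>}. \<bar>U \<epsilon> r\<bar> \<le> C * \<epsilon> powr \<kappa> * ln (1 / \<epsilon>)) \<and>
             (\<forall>r\<in>{0..R - \<epsilon> powr \<kappa>}. r ^ (N - 1) * \<bar>U' \<epsilon> r\<bar> \<le> exp (- M / \<epsilon> powr (1 - \<kappa>))))"
        if "0 < \<kappa> \<and> \<kappa> < 1" for \<kappa>
        using f.bulk_flux_estimate that unfolding abs_minus_cancel by blast
      fix \<beta> \<gamma> and rr :: "real \<Rightarrow> real"
      assume h: "?h \<beta> \<gamma> rr"
      have \<beta>: "\<beta> > 1" and \<gamma>: "\<gamma> \<ge> 0" "\<gamma> > 0 \<or> \<beta> \<ge> 2" using h by auto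
      have ap: "f.approach \<beta> \<gamma> rr"
        using h unfolding f.approach_def by (auto intro: less_imp_le)
      show "((\<lambda>\<epsilon>. U \<epsilon> (rr \<epsilon>)
              - ((2 / p) * min 1 (\<beta> - 1) * ln (1 / \<epsilon>)
                 - (2 / p) * ln (sqrt (B / (2 * p * g R))
                      * (\<gamma> * p * chi1 \<beta> + 2 * real N * g R / (R * (A - B)) * chi2 \<beta>))))
             \<longlongrightarrow> 0) (at_right 0)"
        using tendsto_minus[OF f.U_asym[OF \<beta> ap \<gamma>]] unfolding f.lead_def
        by (simp add: algebra_simps)
    qed (use gt in \<open>blast dest: less_asym\<close>)+
  qed
qed

end
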